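(* Consider problem (P) under the standing assumptions of the context, and let $\{x^k\}$ and $\{\gamma_k\}$ be generated by the algorithm sESQM described in the context. Suppose that: (CQ) $0\notin \partial g(x)+\mathcal{N}_{\mathcal{C}}(x)$ for every $x\in\mathcal{C}$ with $g(x)\ge 0$; (Parameters) $\{\mu_k\}$ is positive and nonincreasing, $\lim_{k\to\infty}\mu_k=0$, and $S_K:=\sum_{k=\lceil K/2\rceil}^{K}\mu_k\to\infty$ as $K\to\infty$; moreover $\lim_{k\to\infty}\widehat\gamma_k=0$ and there is $M_{\widehat\gamma}>1$ with $0<\widehat\gamma_{k+1}<\widehat\gamma_k\le M_{\widehat\gamma}\widehat\gamma_{k+1}$ for all $k\in\mathbb{N}_0$. Let $M_1,\eta_\gamma,M_{\bar t}, Q_0$ be as defined in the context. Then $$M_2:=1+2(M_{\bar t}+1)(Q_0+[\alpha_{3,1}]_+\mu_0)/c_1>0.$$ Moreover, for any $K\in\mathbb{N}_0$ satisfying $K\ge2M_{\bar t}$ and $S_K^{-1}\le(\eta_\gamma c_2)^2/M_2$, there exists an integer $\hat k\in[\lceil K/2\rceil-M_{\bar t},K]$ such that \begin{align*} &x^{\hat k+1}\in\mathcal{C},\quad \lambda_{\hat k+1}\in[0,\eta_\gamma^{-1}],\quad u^{\hat k+1}\in\partial_{\alpha_3^h\mu_{\lceil K/2\rceil-M_{\bar t}}}h(c(x^{\hat k+1})),\\ &\|x^{\hat k+1}-x^{\hat k}\|\le\sqrt{M_2}\,\mu_{\lceil K/2\rceil-M_{\bar t}}S_K^{-1/2},\quad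 \delta_{\hat k+1}\le\eta_\gamma^{-1}M_1\sqrt{M_2}\,S_K^{-1/2},\\ &g^+(x^{\hat k+1})\le(3\alpha_3^\varphi+[\alpha_{3,1}^h]_+)\mu_{\lceil K/2\rceil-M_{\bar t}},\quad |\lambda_{\hat k+1}g(x^{\hat k+1})|\le M_3\,\mu_{\lceil K/2\rceil-M_{\bar t}}, \end{align*} where $M_3:=(3\alpha_3^\varphi+[\alpha_{3,1}^h]_++[\alpha_{3,2}^h]_+)/\eta_\gamma$ and $\lambda_{k+1},u^{k+1},\delta_{k+1}$ are as defined in the context.
   Context: **Notation.** $\mathbb{N}_0=\{0,1,2,\dots\}$; $[s]_+=\max\{s,0\}$; $\phi^+=\max\{\phi,0\}$; $\delta_{\mathcal{C}}$ is the indicator function (0 on $\mathcal{C}$, $+\infty$ off it); $\mathcal{N}_{\mathcal{C}}=\partial\delta_{\mathcal{C}}$ is the normal cone; $\partial_\epsilon\phi(x)=\{\xi:\phi(z)\ge\phi(x)+\langle\xi,z-x\rangle-\epsilon\ \forall z\}$ for convex $\phi$; $\partial$ is the limiting subdifferential (the usual one for convex functions); in the present setting $\partial g(x)=Dc(x)^*\partial h(c(x))$. "$L$-smooth on $\mathcal{C}$" means the derivative is $L$-Lipschitz on $\mathcal{C}$. $Dc(x)^*$ is the adjoint of the derivative. **Problem (P).** $\mathbb{X},\mathbb{Y}$ are finite-dimensional real Hilbert spaces: $$\min_{x\in\mathbb{X}}\ \psi(x):=f(x)+P_1(x)-P_2(x)+\delta_{\mathcal{C}}(x)\quad\text{s.t.}\quad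 g(x):=h(c(x))\le 0.$$ Standing assumptions: (i) $\mathcal{C}\subseteq\mathbb{X}$ is compact and convex and $\mathcal{F}:=\{x\in\mathcal{C}:g(x)\le0\}\ne\emptyset$; (ii) $f:\mathbb{X}\to\mathbb{R}$ and $c:\mathbb{X}\to\mathbb{Y}$ are continuously differentiable, $L_f$-smooth and $L_c$-smooth on $\mathcal{C}$ respectively ($L_f>0$, $L_c\ge0$), and $c$ is $M_c$-Lipschitz on $\mathcal{C}$ with $M_c>0$; (iii) $P_1,P_2:\mathbb{X}\to\mathbb{R}$ are convex; (iv) $h:\mathbb{Y}\to\mathbb{R}$ is convex and $M_h$-Lipschitz with $M_h>0$. **Smoothing.** A family of convex $C^1$ functions $\{\phi_\mu\}_{\mu>0}$ is a smoothing approximation (SA) of a convex $\phi:\mathbb{Y}\to\mathbb{R}$ with parameters $(\alpha_1^\phi,\alpha_2^\phi,\alpha_{3,1}^\phi,\alpha_{3,2}^\phi)$, where $\alpha_1^\phi\ge0$, $\alpha_2^\phi>0$, $\alpha_{3,1}^\phi,\alpha_{3,2}^\phi\in\mathbb{R}$ and $\alpha_3^\phi:=\alpha_{3,1}^\phi+\alpha_{3,2}^\phi>0$, if for all $\mu>0$: $\nabla\phi_\mu$ is $(\alpha_1^\phi+\alpha_2^\phi/\mu)$-Lipschitz and $\phi-\alpha_{3,1}^\phi\mu\le\phi_\mu\le\phi+\alpha_{3,2}^\phi\mu$ pointwise. Fixed throughout: an SA $\{h_\mu\}$ of $h$ with parameters $(\alpha_1^h,\alpha_2^h,\alpha_{3,1}^h,\alpha_{3,2}^h)$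 and a constant $\alpha_4^h\ge0$ with $h_{\mu_1}(y)\le h_{\mu_0}(y)+\alpha_4^h(\mu_0-\mu_1)$ for all $\mu_0\ge\mu_1>0$, $y\in\mathbb{Y}$; and an SA $\{\varphi_\mu\}$ of $[\cdot]_+:\mathbb{R}\to\mathbb{R}$ with parameters $(\alpha_1^\varphi,\alpha_2^\varphi,\alpha_{3,1}^\varphi,\alpha_{3,2}^\varphi)$ and a constant $\alpha_4^\varphi\ge0$ with $\varphi_{\mu_1}(s)\le\varphi_{\mu_0}(s)+\alpha_4^\varphi(\mu_0-\mu_1)$ for all $\mu_0\ge\mu_1>0$, $s\in\mathbb{R}$. Set $H_\mu:=\varphi_\mu\circ h_\mu$, $g_\mu:=H_\mu\circ c$, $\alpha_1=\alpha_1^h+M_h^2\alpha_1^\varphi$, $\alpha_2=\alpha_2^h+M_h^2\alpha_2^\varphi$, $\alpha_{3,1}=[\alpha_{3,1}^h]_++\alpha_{3,1}^\varphi$, $\alpha_4=\alpha_4^h+\alpha_4^\varphi$, and $L_\mu:=M_hL_c+\alpha_1M_c^2+\alpha_2M_c^2/\mu$. **Algorithm sESQM.** Inputs: $x^0\in\mathcal{C}$, $\mu_0>0$, $\overline L\ge\underline L>0$, $c_1>0$, $c_2>0$, a strictly decreasing positive sequence $\{\widehat\gamma_k\}$, and the SAs above. Set $t_0=0$. For $k=0,1,2,\dots$: Step 1: take $\xi^k\in\partial P_2(x^k)$, $L_{k,0}\in[\underline L,\overline L]$; set $\gamma_k=\widehat\gamma_{t_k}$, $\widetilde L=L_{k,0}$.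 Step 2: compute $\widetilde x=\arg\min_{x\in\mathbb{X}}\{\gamma_k(\langle\nabla f(x^k)-\xi^k,x\rangle+P_1(x))+\ell_k(x)+\frac{\widetilde L}{2\mu_k}\|x-x^k\|^2+\delta_{\mathcal{C}}(x)\}$ with $\ell_k(x):=g_{\mu_k}(x^k)+\langle\nabla g_{\mu_k}(x^k),x-x^k\rangle$. Step 3: if $\gamma_k\psi(\widetilde x)+g_{\mu_k}(\widetilde x)\le\gamma_k\psi(x^k)+g_{\mu_k}(x^k)-\frac{c_1}{2\mu_k}\|\widetilde x-x^k\|^2$ go to Step 4; otherwise replace $\widetilde L$ by $2\widetilde L$ and go to Step 2. Step 4: set $x^{k+1}=\widetilde x$, $L_k=\widetilde L$. If $h_{\mu_k}(c(x^{k+1}))>2\alpha_3^\varphi\mu_k$ and $\|x^{k+1}-x^k\|\le c_2\mu_k\gamma_k$, set $t_{k+1}=t_k+1$; otherwise $t_{k+1}=t_k$. Step 5: choose $\mu_{k+1}\in(0,\mu_k]$. **Constants.** $M_L:=\max\{\overline L,\ c_1+\gamma_0\mu_0L_f+\mu_0L_{\mu_0}\}$; $M_f:=\sup_{x\in\mathcal{C}}\|\nabla f(x)\|$; $M_{P_i}:=\sup\{\|\xi\|:\xi\in\partial P_i(x),x\in\mathcal{C}\}$, $i=1,2$; $M_1:=M_L+\mu_0\widehat\gamma_0L_f+\mu_0L_{\mu_0}$; $Q_k:=\gamma_k(\psi(x^k)-\bar m)+g_{\mu_k}(x^k)+\alpha_4\mu_k$ with $\bar m:=\inf_{x\in\mathbb{X}}\psi(x)>-\infty$.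 $\eta_1>0$ is a constant (which exists under the standing assumptions and (CQ)) such that $\mathrm{dist}(0,Dc(x)^*u+\mathcal{N}_{\mathcal{C}}(x))\ge\eta_1$ for every $x\in\mathcal{C}$ with $g(x)\ge-\eta_1$ and every $u\in\partial_{\eta_1}h(c(x))$. With $k_0:=\min\{k\in\mathbb{N}_0:\mu_k\le\eta_1/\max\{\alpha_3^h,[\alpha_{3,2}^h]_+\}\}$, $$\eta_\gamma:=\min\left\{\frac{\eta_1}{2M_{\widehat\gamma}(M_f+M_{P_1}+M_{P_2}+c_2(M_L+\mu_0L_{\mu_0}))},\widehat\gamma_{k_0+1}\right\},\qquad M_{\bar t}:=\max\{t\in\mathbb{N}_0:\widehat\gamma_t\ge\eta_\gamma\}.$$ **Sequences.** $\lambda_{k+1}:=\gamma_k^{-1}\varphi_{\mu_k}'(h_{\mu_k}(c(x^{k+1})))$; $u^{k+1}:=\nabla h_{\mu_k}(c(x^{k+1}))$; $\delta_{k+1}:=\mathrm{dist}\big(0,\ \nabla f(x^{k+1})-\partial P_2(x^k)+\partial P_1(x^{k+1})+\lambda_{k+1}Dc(x^{k+1})^*u^{k+1}+\mathcal{N}_{\mathcal{C}}(x^{k+1})\big)$. *)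

theory Defs
  imports "HOL-Analysis.Analysis"
begin

text \<open>The Frechet derivative as an element of the normed space of bounded linear maps, so that
  continuity and Lipschitz continuity of the derivative refer to the operator norm.
  Only meaningful where the function is differentiable.\<close>

definition jac :: "('a::euclidean_space \<Rightarrow> 'b::euclidean_space) \<Rightarrow> 'a \<Rightarrow> 'a \<Rightarrow>\<^sub>L 'b"
  where "jac F x = Blinfun (frechet_derivative F (at x))"

definition grad :: "('a::euclidean_space \<Rightarrow> real) \<Rightarrow> 'a \<Rightarrow> 'a"
  where "grad \<phi> x = (THE D. GDERIV \<phi> x :> D)"

definition continuously_differentiable :: "('a::euclidean_space \<Rightarrow> 'b::euclidean_space) \<Rightarrow> bool"
  where "continuously_differentiable F \<longleftrightarrow>
    (\<forall>x. F differentiable (at x)) \<and> continuous_on UNIV (jac F)"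

definition smooth_on_set :: "real \<Rightarrow> 'a set \<Rightarrow> ('a::euclidean_space \<Rightarrow> 'b::euclidean_space) \<Rightarrow> bool"
  where "smooth_on_set L C F \<longleftrightarrow> L-lipschitz_on C (jac F)"

definition delta :: "'a set \<Rightarrow> 'a \<Rightarrow> ereal"
  where "delta C x = (if x \<in> C then 0 else \<infinity>)"

text \<open>Used for convex functions only.\<close>

definition eps_subdiff :: "real \<Rightarrow> ('a::euclidean_space \<Rightarrow> ereal) \<Rightarrow> 'a \<Rightarrow> 'a set"
  where "eps_subdiff \<epsilon> \<phi> x = {\<xi>. \<forall>z. \<phi> z \<ge> \<phi> x + ereal (\<xi> \<bullet> (z - x)) - ereal \<epsilon>}"

definition subdiff :: "('a::euclidean_space \<Rightarrow> ereal) \<Rightarrow> 'a \<Rightarrow> 'a set"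
  where "subdiff \<phi> x = eps_subdiff 0 \<phi> x"

definition normal_cone :: "('a::euclidean_space) set \<Rightarrow> 'a \<Rightarrow> 'a set"
  where "normal_cone C x = subdiff (delta C) x"

text \<open>The regular (Frechet) and the limiting (Mordukhovich) subdifferential of a possibly
  nonconvex real-valued function.\<close>

definition regular_subdiff :: "('a::euclidean_space \<Rightarrow> real) \<Rightarrow> 'a \<Rightarrow> 'a set"
  where "regular_subdiff \<phi> x =
    {v. 0 \<le> Liminf (at x) (\<lambda>y. ereal ((\<phi> y - \<phi> x - v \<bullet> (y - x)) / norm (y - x)))}"

definition limiting_subdiff :: "('a::euclidean_space \<Rightarrow> real) \<Rightarrow> 'a \<Rightarrow> 'a set"
  where "limiting_subdiff \<phi> x =
    {v. \<exists>X V. X \<longlonglongrightarrow> x \<and> (\<lambda>n. \<phi> (X n)) \<longlonglongrightarrow> \<phi> x \<and> V \<longlonglongrightarrow> v \<and>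
         (\<forall>n. V n \<in> regular_subdiff \<phi> (X n))}"

definition smoothing_approx ::
  "('b::euclidean_space \<Rightarrow> real) \<Rightarrow> (real \<Rightarrow> 'b \<Rightarrow> real) \<Rightarrow> real \<Rightarrow> real \<Rightarrow> real \<Rightarrow> real \<Rightarrow> bool"
  where "smoothing_approx \<phi> \<Phi> a1 a2 a31 a32 \<longleftrightarrow>
    a1 \<ge> 0 \<and> a2 > 0 \<and> a31 + a32 > 0 \<and>
    (\<forall>\<mu>>0. convex_on UNIV (\<Phi> \<mu>) \<and> continuously_differentiable (\<Phi> \<mu>) \<and>
       (a1 + a2 / \<mu>)-lipschitz_on UNIV (grad (\<Phi> \<mu>)) \<and>
       (\<forall>y. \<phi> y - a31 * \<mu> \<le> \<Phi> \<mu> y \<and> \<Phi> \<mu> y \<le> \<phi> y + a32 * \<mu>))"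

definition smoothing_monotone :: "(real \<Rightarrow> 'b \<Rightarrow> real) \<Rightarrow> real \<Rightarrow> bool"
  where "smoothing_monotone \<Phi> a4 \<longleftrightarrow> a4 \<ge> 0 \<and>
    (\<forall>\<mu>0 \<mu>1 y. \<mu>0 \<ge> \<mu>1 \<and> \<mu>1 > 0 \<longrightarrow> \<Phi> \<mu>1 y \<le> \<Phi> \<mu>0 y + a4 * (\<mu>0 - \<mu>1))"

definition objective ::
  "('a \<Rightarrow> real) \<Rightarrow> ('a \<Rightarrow> real) \<Rightarrow> ('a \<Rightarrow> real) \<Rightarrow> 'a set \<Rightarrow> 'a \<Rightarrow> ereal"
  where "objective f P1 P2 C x = ereal (f x + P1 x - P2 x) + delta C x"

definition smoothed_constraint ::
  "(real \<Rightarrow> real \<Rightarrow> real) \<Rightarrow> (real \<Rightarrow> 'b \<Rightarrow> real) \<Rightarrow> ('a \<Rightarrow> 'b) \<Rightarrow> real \<Rightarrow> 'a \<Rightarrow> real"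
  where "smoothed_constraint \<phi>s hs c \<mu> = (\<lambda>x. \<phi>s \<mu> (hs \<mu> (c x)))"

definition subproblem ::
  "('a::euclidean_space \<Rightarrow> real) \<Rightarrow> ('a \<Rightarrow> real) \<Rightarrow> 'a set \<Rightarrow> ('a \<Rightarrow> real) \<Rightarrow>
   real \<Rightarrow> real \<Rightarrow> 'a \<Rightarrow> 'a \<Rightarrow> real \<Rightarrow> 'a \<Rightarrow> ereal"
  where "subproblem f P1 C g\<mu> \<gamma> \<mu> xk \<xi> L x =
    ereal (\<gamma> * ((grad f xk - \<xi>) \<bullet> x + P1 x)
           + (g\<mu> xk + grad g\<mu> xk \<bullet> (x - xk))
           + L / (2 * \<mu>) * (norm (x - xk))\<^sup>2)
    + delta C x"

definition sufficient_decrease ::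
  "('a::euclidean_space \<Rightarrow> ereal) \<Rightarrow> ('a \<Rightarrow> real) \<Rightarrow> real \<Rightarrow> real \<Rightarrow> real \<Rightarrow> 'a \<Rightarrow> 'a \<Rightarrow> bool"
  where "sufficient_decrease \<psi> g\<mu> c1 \<gamma> \<mu> xk y \<longleftrightarrow>
    ereal \<gamma> * \<psi> y + ereal (g\<mu> y)
      \<le> ereal \<gamma> * \<psi> xk + ereal (g\<mu> xk) - ereal (c1 / (2 * \<mu>) * (norm (y - xk))\<^sup>2)"

text \<open>Backtracking in one iteration: \<open>y j\<close> is the trial point computed with
  \<open>2 ^ j * L0\<close>; the first \<open>i\<close> trials are rejected and trial \<open>i\<close> is accepted as \<open>xnew\<close>.
  The accepted value of \<open>L\<close> is not recorded because no later step uses it.\<close>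

definition sESQM_step ::
  "('a::euclidean_space \<Rightarrow> real) \<Rightarrow> ('a \<Rightarrow> real) \<Rightarrow> ('a \<Rightarrow> real) \<Rightarrow> 'a set \<Rightarrow> ('a \<Rightarrow> real) \<Rightarrow>
   real \<Rightarrow> real \<Rightarrow> real \<Rightarrow> real \<Rightarrow> real \<Rightarrow> 'a \<Rightarrow> 'a \<Rightarrow> bool"
  where "sESQM_step f P1 P2 C g\<mu> Llow Lup c1 \<gamma> \<mu> xk xnew \<longleftrightarrow>
    (\<exists>\<xi> \<in> subdiff (\<lambda>x. ereal (P2 x)) xk. \<exists>L0 \<in> {Llow..Lup}. \<exists>i y.
       (\<forall>j\<le>i. is_arg_min (subproblem f P1 C g\<mu> \<gamma> \<mu> xk \<xi> (2 ^ j * L0)) (\<lambda>_. True) (y j)) \<and>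
       (\<forall>j<i. \<not> sufficient_decrease (objective f P1 P2 C) g\<mu> c1 \<gamma> \<mu> xk (y j)) \<and>
       sufficient_decrease (objective f P1 P2 C) g\<mu> c1 \<gamma> \<mu> xk (y i) \<and>
       xnew = y i)"

text \<open>\<open>x\<close>, \<open>\<mu>\<close>, \<open>t\<close>, \<open>\<gamma>\<close> are (infinite) sequences generated by sESQM; \<open>\<phi>3\<close> is the constant
  \<open>\<alpha>\<^sub>3\<close> of the smoothing \<open>\<phi>s\<close> of the positive part.\<close>

definition sESQM_generated ::
  "('a::euclidean_space \<Rightarrow> real) \<Rightarrow> ('a \<Rightarrow> real) \<Rightarrow> ('a \<Rightarrow> real) \<Rightarrow> 'a set \<Rightarrow> ('a \<Rightarrow> 'b) \<Rightarrow>
   (real \<Rightarrow> 'b \<Rightarrow> real) \<Rightarrow> (real \<Rightarrow> real \<Rightarrow> real) \<Rightarrow> real \<Rightarrow>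
   real \<Rightarrow> real \<Rightarrow> real \<Rightarrow> real \<Rightarrow> (nat \<Rightarrow> real) \<Rightarrow>
   (nat \<Rightarrow> 'a) \<Rightarrow> (nat \<Rightarrow> real) \<Rightarrow> (nat \<Rightarrow> nat) \<Rightarrow> (nat \<Rightarrow> real) \<Rightarrow> bool"
  where "sESQM_generated f P1 P2 C c hs \<phi>s \<phi>3 Llow Lup c1 c2 \<gamma>hat x \<mu> t \<gamma> \<longleftrightarrow>
    x 0 \<in> C \<and> \<mu> 0 > 0 \<and> t 0 = 0 \<and>
    (\<forall>k. \<gamma> k = \<gamma>hat (t k) \<and>
       sESQM_step f P1 P2 C (smoothed_constraint \<phi>s hs c (\<mu> k)) Llow Lup c1 (\<gamma> k) (\<mu> k)
         (x k) (x (Suc k)) \<and>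
       t (Suc k) =
         (if hs (\<mu> k) (c (x (Suc k))) > 2 * \<phi>3 * \<mu> k \<and> norm (x (Suc k) - x k) \<le> c2 * \<mu> k * \<gamma> k
          then t k + 1 else t k) \<and>
       \<mu> (Suc k) \<in> {0<..\<mu> k})"

definition CQ :: "('a::euclidean_space) set \<Rightarrow> ('a \<Rightarrow> real) \<Rightarrow> bool"
  where "CQ C g \<longleftrightarrow>
    (\<forall>x\<in>C. g x \<ge> 0 \<longrightarrow> 0 \<notin> {v + n |v n. v \<in> limiting_subdiff g x \<and> n \<in> normal_cone C x})"

text \<open>The library function \<open>infdist\<close> is the point-to-set distance, except that its value for the
  empty set is 0. The sets below are nonempty for \<open>x \<in> C\<close>, as \<open>0\<close> is a normal vector and convex
  real-valued functions have subgradients everywhere.\<close>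

definition CQ_constant ::
  "('a::euclidean_space) set \<Rightarrow> ('a \<Rightarrow> 'b::euclidean_space) \<Rightarrow> ('b \<Rightarrow> real) \<Rightarrow> real \<Rightarrow> bool"
  where "CQ_constant C c h \<eta> \<longleftrightarrow> \<eta> > 0 \<and>
    (\<forall>x\<in>C. h (c x) \<ge> - \<eta> \<longrightarrow> (\<forall>u \<in> eps_subdiff \<eta> (\<lambda>y. ereal (h y)) (c x).
       infdist 0 {adjoint (blinfun_apply (jac c x)) u + n |n. n \<in> normal_cone C x} \<ge> \<eta>))"

definition stationarity_residual ::
  "('a::euclidean_space \<Rightarrow> real) \<Rightarrow> ('a \<Rightarrow> real) \<Rightarrow> ('a \<Rightarrow> real) \<Rightarrow> 'a set \<Rightarrow>
   ('a \<Rightarrow> 'b::euclidean_space) \<Rightarrow> 'a \<Rightarrow> 'a \<Rightarrow> real \<Rightarrow> 'b \<Rightarrow> real"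
  where "stationarity_residual f P1 P2 C c xk xnew lam u =
    infdist 0 {grad f xnew - \<zeta> + \<xi> + lam *\<^sub>R adjoint (blinfun_apply (jac c xnew)) u + n |\<zeta> \<xi> n.
      \<zeta> \<in> subdiff (\<lambda>x. ereal (P2 x)) xk \<and>
      \<xi> \<in> subdiff (\<lambda>x. ereal (P1 x)) xnew \<and>
      n \<in> normal_cone C xnew}"

definition subgradient_bound :: "('a::euclidean_space \<Rightarrow> real) \<Rightarrow> 'a set \<Rightarrow> real"
  where "subgradient_bound P C = Sup {norm \<xi> |\<xi> x. \<xi> \<in> subdiff (\<lambda>x. ereal (P x)) x \<and> x \<in> C}"

end

theory Submission
  imports Defs
begin

text \<open>
  A merit function, the penalised objective gap plus the smoothed constraint, decreases in every
  iteration by a multiple of \<open>\<parallel>x\<^sup>k\<^sup>+\<^sup>1 - x\<^sup>k\<parallel>\<^sup>2 / \<mu>\<^sub>k\<close>: the subproblem is strongly convex, the linearised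
  parts satisfy a descent lemma on \<open>C\<close>, and both the penalty parameter and the smoothing parameter
  move in the right direction. The merit function is bounded below, so these quantities have a
  finite sum (\<open>sum_steps_le\<close>).

  The penalty parameter stays away from zero (\<open>t_bounded\<close>). It is lowered only after a short step
  to a point where the smoothed constraint is clearly positive. There the optimality condition of
  the subproblem expresses a combination of a constraint gradient, with weight at least \<open>1/2\<close>, and a
  normal vector as a quantity of order \<open>\<gamma>\<^sub>k\<close>. For small \<open>\<mu>\<^sub>k\<close> the constraint qualification, made
  uniform by compactness (\<open>CQ_imp_CQ_constant\<close>), keeps that combination away from zero, so \<open>\<gamma>\<^sub>k\<close>
  cannot have been small. Hence there are at most \<open>M\<^sub>t\<close> updates in total.

  In a window that extends \<open>{\<lceil>K/2\<rceil>..K}\<close> by \<open>M\<^sub>t\<close> indices to the left, the indices without an update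
  therefore still carry \<open>\<mu>\<close>-weight at least \<open>S\<^sub>K\<close>, as \<open>\<mu>\<close> is nonincreasing. Averaging the finite sum
  over them gives an index whose step is at most \<open>sqrt (M\<^sub>2 / S\<^sub>K) * \<mu>\<^sub>k\<close> (\<open>exists_short_step\<close>). This step
  passes the length test of the update rule; since no update happened, the other test failed, which
  is approximate feasibility. All remaining estimates at this index follow from the optimality
  condition of the subproblem and from convexity of the smoothings.

  One difficulty is geometric. The set \<open>C\<close> may have empty interior, and then the Lipschitz constant
  of \<open>c\<close> on \<open>C\<close> controls the derivative of \<open>c\<close> only along the affine hull of \<open>C\<close>. Gradients of the
  smoothed constraint are therefore compared only along these directions; the orthogonal part is
  absorbed by the normal cone (\<open>normal_cone_absorbs_orthogonal\<close>).
\<close>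

section \<open>Gradients, Jacobians and the descent lemma\<close>

lemma grad_eqI:
  assumes "GDERIV \<phi> x :> D"
  shows "grad \<phi> x = D"
  unfolding grad_def
proof (rule the_equality)
  fix D' assume "GDERIV \<phi> x :> D'"
  then have "(\<lambda>d. d \<bullet> D') = (\<lambda>d. d \<bullet> D)"
    using assms unfolding gderiv_def by (rule has_derivative_unique)
  then show "D' = D"
    by (metis vector_eq_ldot)
qed (rule assms)

lemma has_derivative_jac:
  assumes "F differentiable (at x)"
  shows "(F has_derivative blinfun_apply (jac F x)) (at x)"
proof -
  have "(F has_derivative frechet_derivative F (at x)) (at x)"
    using assms by (simp add: frechet_derivative_works)
  then show ?thesis
    unfolding jac_def using bounded_linear_Blinfun_apply has_derivative_bounded_linear by fastforce
qed

lemma GDERIV_grad: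
  assumes "\<phi> differentiable (at x)"
  shows "GDERIV \<phi> x :> grad \<phi> x"
proof -
  interpret bounded_linear "blinfun_apply (jac \<phi> x)"
    by (rule blinfun.bounded_linear_right)
  have "GDERIV \<phi> x :> adjoint (blinfun_apply (jac \<phi> x)) 1"
    unfolding gderiv_def
    using has_derivative_jac[OF assms] by (simp add: adjoint_works linear_axioms)
  then show ?thesis
    by (simp add: grad_eqI)
qed

lemma jac_apply_eq_inner_grad:
  assumes "\<phi> differentiable (at x)"
  shows "blinfun_apply (jac \<phi> x) d = d \<bullet> grad \<phi> x"
  using has_derivative_unique[OF has_derivative_jac[OF assms] GDERIV_grad[OF assms, unfolded gderiv_def]]
  by metis

lemma deriv_eq_grad:
  fixes \<phi> :: "real \<Rightarrow> real"
  assumes "\<phi> differentiable (at s)"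
  shows "deriv \<phi> s = grad \<phi> s"
  using GDERIV_grad[OF assms] by (simp add: DERIV_imp_deriv)

lemma norm_grad_diff_le:
  assumes "\<phi> differentiable (at x)" "\<phi> differentiable (at y)"
  shows "norm (grad \<phi> x - grad \<phi> y) \<le> norm (jac \<phi> x - jac \<phi> y)"
proof -
  let ?v = "grad \<phi> x - grad \<phi> y"
  have "norm ?v * norm ?v = blinfun_apply (jac \<phi> x - jac \<phi> y) ?v"
    by (simp add: blinfun.diff_left jac_apply_eq_inner_grad assms flip: inner_diff_right power2_eq_square
        power2_norm_eq_inner)
  also have "\<dots> \<le> norm (jac \<phi> x - jac \<phi> y) * norm ?v"
    using norm_blinfun[of "jac \<phi> x - jac \<phi> y" ?v] by simp
  finally show ?thesis
    by (cases "?v = 0") (auto simp: mult_le_cancel_right)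
qed

lemma grad_lipschitz_on:
  assumes "\<And>x. \<phi> differentiable (at x)" "L-lipschitz_on C (jac \<phi>)"
  shows "L-lipschitz_on C (grad \<phi>)"
proof (rule lipschitz_onI)
  fix x y assume "x \<in> C" "y \<in> C"
  then show "dist (grad \<phi> x) (grad \<phi> y) \<le> L * dist x y"
    using norm_grad_diff_le[of \<phi> x y] lipschitz_onD[OF assms(2), of x y] assms(1)
    by (simp add: dist_norm)
qed (rule lipschitz_on_nonneg[OF assms(2)])

lemma adjoint_blinfun:
  fixes A :: "'a::euclidean_space \<Rightarrow>\<^sub>L 'b::euclidean_space"
  shows "d \<bullet> adjoint (blinfun_apply A) u = blinfun_apply A d \<bullet> u"
  by (intro adjoint_works bounded_linear.linear blinfun.bounded_linear_right)

text \<open>Along the segment from \<open>x\<close> to \<open>y\<close> the function minus its linearisation minus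
  \<open>L/2 t\<^sup>2 \<parallel>y - x\<parallel>\<^sup>2\<close> has nonpositive derivative, so the Lipschitz estimate
  is needed only in the direction \<open>y - x\<close>. This matters when \<open>C\<close> has empty interior: the
  Lipschitz constant of \<open>c\<close> on \<open>C\<close> controls its derivative only in directions along \<open>C\<close>.\<close>

lemma descent_lemma:
  fixes \<phi> :: "'a::euclidean_space \<Rightarrow> real"
  assumes diff: "\<And>z. \<phi> differentiable (at z)"
    and "convex C" and xy: "x \<in> C" "y \<in> C"
    and lip: "\<And>z. z \<in> C \<Longrightarrow> (y - x) \<bullet> (grad \<phi> z - grad \<phi> x) \<le> L * norm (z - x) * norm (y - x)"
  shows "\<phi> y \<le> \<phi> x + grad \<phi> x \<bullet> (y - x) + L / 2 * (norm (y - x))\<^sup>2"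
proof -
  define p where "p = (\<lambda>t. \<phi> (x + t *\<^sub>R (y - x)) - t * ((y - x) \<bullet> grad \<phi> x) - L / 2 * t\<^sup>2 * (norm (y - x))\<^sup>2)"
  have deriv: "(p has_real_derivative
      (y - x) \<bullet> (grad \<phi> (x + t *\<^sub>R (y - x)) - grad \<phi> x) - L * t * (norm (y - x))\<^sup>2) (at t)" for t
  proof -
    have "((\<lambda>t. \<phi> (x + t *\<^sub>R (y - x))) has_derivative (\<lambda>s. (s *\<^sub>R (y - x)) \<bullet> grad \<phi> (x + t *\<^sub>R (y - x)))) (at t)"
      by (rule has_derivative_compose[OF _ GDERIV_grad[OF diff, unfolded gderiv_def]])
        (auto intro!: derivative_eq_intros)
    then have "((\<lambda>t. \<phi> (x + t *\<^sub>R (y - x))) has_real_derivative (y - x) \<bullet> grad \<phi> (x + t *\<^sub>R (y - x))) (at t)"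
      by (simp add: has_field_derivative_def mult.commute[of _ "_ \<bullet> _"])
    then show ?thesis
      unfolding p_def
      by (auto intro!: derivative_eq_intros simp: inner_diff_right power2_eq_square)
  qed
  have "p 1 \<le> p 0"
  proof (rule DERIV_nonpos_imp_nonincreasing[of 0 1 p])
    fix t :: real assume t: "0 \<le> t" "t \<le> 1"
    have "x + t *\<^sub>R (y - x) = (1 - t) *\<^sub>R x + t *\<^sub>R y"
      by (simp add: algebra_simps)
    then have "x + t *\<^sub>R (y - x) \<in> C"
      using t xy convexD_alt[OF \<open>convex C\<close>] by simp
    from lip[OF this] have "(y - x) \<bullet> (grad \<phi> (x + t *\<^sub>R (y - x)) - grad \<phi> x) - L * t * (norm (y - x))\<^sup>2 \<le> 0"
      using t by (simp add: power2_eq_square mult_ac)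
    then show "\<exists>y. DERIV p t :> y \<and> y \<le> 0"
      using deriv by blast
  qed simp
  then show ?thesis
    by (simp add: p_def inner_commute)
qed

section \<open>Convex functions and normal cones\<close>

lemma eps_subdiff_real:
  "\<xi> \<in> eps_subdiff e (\<lambda>z. ereal (\<phi> z)) x \<longleftrightarrow> (\<forall>z. \<phi> x + \<xi> \<bullet> (z - x) - e \<le> \<phi> z)"
  by (simp add: eps_subdiff_def)

lemma subdiff_real:
  "\<xi> \<in> subdiff (\<lambda>z. ereal (\<phi> z)) x \<longleftrightarrow> (\<forall>z. \<phi> x + \<xi> \<bullet> (z - x) \<le> \<phi> z)"
  unfolding subdiff_def by (simp add: eps_subdiff_real)

lemma eps_subdiff_mono:
  assumes "\<xi> \<in> eps_subdiff e (\<lambda>z. ereal (\<phi> z)) x" "e \<le> e'"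
  shows "\<xi> \<in> eps_subdiff e' (\<lambda>z. ereal (\<phi> z)) x"
  using assms unfolding eps_subdiff_real by (meson diff_left_mono order_trans)

lemma normal_cone_iff:
  assumes "x \<in> C"
  shows "n \<in> normal_cone C x \<longleftrightarrow> (\<forall>z\<in>C. n \<bullet> (z - x) \<le> 0)"
  using assms by (auto simp: normal_cone_def subdiff_def eps_subdiff_def delta_def)

lemma normal_cone_add:
  assumes "x \<in> C" "n \<in> normal_cone C x" "m \<in> normal_cone C x"
  shows "n + m \<in> normal_cone C x"
  using assms by (auto simp: normal_cone_iff inner_add_left intro: add_nonpos_nonpos)

lemma normal_cone_scaleR:
  assumes "x \<in> C" "n \<in> normal_cone C x" "0 \<le> r"
  shows "r *\<^sub>R n \<in> normal_cone C x"
  using assms by (auto simp: normal_cone_iff mult_nonneg_nonpos)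

text \<open>Far out in direction \<open>\<xi>\<close> the affine minorant given by \<open>\<xi>\<close> grows with rate \<open>\<parallel>\<xi>\<parallel>\<close>, which
  a function growing at rate \<open>M\<close> cannot dominate unless \<open>\<parallel>\<xi>\<parallel> \<le> M\<close>. Constants such as \<open>e\<close> and \<open>b\<close>
  do not affect this, so the bound also covers smoothings at bounded distance.\<close>

lemma eps_subgradient_norm_le:
  assumes \<xi>: "\<xi> \<in> eps_subdiff e (\<lambda>z. ereal (\<phi> z)) x"
    and growth: "\<And>z. \<phi> z \<le> \<phi> x + M * norm (z - x) + b"
    and "M \<ge> 0"
  shows "norm \<xi> \<le> M"
proof (rule ccontr)
  assume "\<not> norm \<xi> \<le> M"
  then have gt: "norm \<xi> - M > 0" by simp
  with \<open>M \<ge> 0\<close> have nz: "\<xi> \<noteq> 0" by auto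
  define r where "r = (\<bar>b\<bar> + \<bar>e\<bar> + 1) / (norm \<xi> - M)"
  have "r \<ge> 0" using gt by (simp add: r_def)
  define z where "z = x + (r / norm \<xi>) *\<^sub>R \<xi>"
  have "\<xi> \<bullet> (z - x) = r * norm \<xi>"
    using nz by (simp add: z_def dot_square_norm power2_eq_square)
  moreover have "norm (z - x) = r"
    using nz \<open>r \<ge> 0\<close> by (simp add: z_def)
  ultimately have "r * norm \<xi> - e \<le> M * r + b"
    using \<xi>[unfolded eps_subdiff_real, rule_format, of z] growth[of z] by simp
  then have "r * (norm \<xi> - M) \<le> b + e" by (simp add: algebra_simps)
  moreover have "r * (norm \<xi> - M) = \<bar>b\<bar> + \<bar>e\<bar> + 1"
    using gt by (simp add: r_def)
  ultimately show False by linarith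
qed

lemma convex_on_above_tangent:
  fixes \<phi> :: "'a::euclidean_space \<Rightarrow> real"
  assumes "convex_on UNIV \<phi>" "\<phi> differentiable (at x)"
  shows "\<phi> x + grad \<phi> x \<bullet> (z - x) \<le> \<phi> z"
proof (rule field_le_epsilon)
  fix e :: real assume "e > 0"
  define e' where "e' = e / (norm (z - x) + 1)"
  have "norm (z - x) + 1 > 0"
    using norm_ge_zero[of "z - x"] by linarith
  then have "e' > 0" "e' * norm (z - x) \<le> e"
    using \<open>e > 0\<close> by (auto simp: e'_def field_simps)
  obtain d where d: "d > 0" "\<And>y. norm (y - x) < d \<Longrightarrow>
      norm (\<phi> y - \<phi> x - (y - x) \<bullet> grad \<phi> x) \<le> e' * norm (y - x)"
    using GDERIV_grad[OF assms(2)] \<open>e' > 0\<close> unfolding gderiv_def has_derivative_at_alt by meson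
  define t where "t = min 1 (d / 2 / (norm (z - x) + 1))"
  have t: "0 < t" "t \<le> 1"
    using d \<open>norm (z - x) + 1 > 0\<close> by (auto simp: t_def)
  have "t * norm (z - x) \<le> (d / 2 / (norm (z - x) + 1)) * norm (z - x)"
    by (intro mult_right_mono) (auto simp: t_def)
  also have "\<dots> \<le> d / 2"
    using d \<open>norm (z - x) + 1 > 0\<close> by (simp add: field_simps)
  also have "\<dots> < d" using d by simp
  finally have "norm ((x + t *\<^sub>R (z - x)) - x) < d"
    using t by simp
  from d(2)[OF this] have 1: "\<phi> (x + t *\<^sub>R (z - x)) \<ge> \<phi> x + t * (grad \<phi> x \<bullet> (z - x)) - t * (e' * norm (z - x))"
    using t by (simp add: abs_le_iff inner_commute mult_ac)
  have "\<phi> ((1 - t) *\<^sub>R x + t *\<^sub>R z) \<le> (1 - t) * \<phi> x + t * \<phi> z"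
    using assms(1) t by (intro convex_onD) auto
  moreover have "(1 - t) *\<^sub>R x + t *\<^sub>R z = x + t *\<^sub>R (z - x)"
    by (simp add: algebra_simps)
  ultimately have "t * (grad \<phi> x \<bullet> (z - x) - e' * norm (z - x)) \<le> t * (\<phi> z - \<phi> x)"
    using 1 by (simp add: algebra_simps)
  then show "\<phi> x + grad \<phi> x \<bullet> (z - x) \<le> \<phi> z + e"
    using t \<open>e' * norm (z - x) \<le> e\<close> by simp
qed

text \<open>This is the sum rule for the subdifferential of \<open>P\<close> plus a linear form plus the indicator
  of \<open>C\<close>. The strict epigraph of \<open>P - P x\<close> and the region of \<open>C \<times> \<real>\<close> below the negated linear form
  are disjoint by minimality; a separating hyperplane is not vertical because \<open>P\<close> is finite
  everywhere, and its slope is the subgradient.\<close>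

lemma convex_minimizer_subgradient_normal:
  fixes P :: "'a::euclidean_space \<Rightarrow> real"
  assumes P: "convex_on UNIV P" and "convex C" "x \<in> C"
    and min: "\<And>z. z \<in> C \<Longrightarrow> P x \<le> P z + a \<bullet> (z - x)"
  shows "\<exists>\<xi> n. \<xi> \<in> subdiff (\<lambda>z. ereal (P z)) x \<and> n \<in> normal_cone C x \<and> a + \<xi> + n = 0"
proof -
  define A where "A = {(z, r). P z - P x < r}"
  define B where "B = {(z, r). z \<in> C \<and> r \<le> - (a \<bullet> (z - x))}"
  have "convex A"
    unfolding convex_alt
  proof clarify
    fix z r z' r' and t :: real
    assume *: "(z, r) \<in> A" "(z', r') \<in> A" "0 \<le> t" "t \<le> 1"
    have "P ((1 - t) *\<^sub>R z + t *\<^sub>R z') \<le> (1 - t) * P z + t * P z'"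
      using P * by (intro convex_onD) auto
    moreover have "(1 - t) * (P z - P x) + t * (P z' - P x) < (1 - t) * r + t * r'"
    proof (cases "t = 0")
      case False
      then have "t * (P z' - P x) < t * r'" using * by (simp add: A_def)
      moreover have "(1 - t) * (P z - P x) \<le> (1 - t) * r"
        using * by (intro mult_left_mono) (auto simp: A_def)
      ultimately show ?thesis by linarith
    qed (use * in \<open>simp add: A_def\<close>)
    moreover have "(1 - t) * (P z - P x) + t * (P z' - P x) = (1 - t) * P z + t * P z' - P x"
      by (simp add: algebra_simps)
    ultimately show "(1 - t) *\<^sub>R (z, r) + t *\<^sub>R (z', r') \<in> A"
      by (simp add: A_def)
  qed
  moreover have "convex B"
    unfolding convex_alt
  proof clarify
    fix z r z' r' and t :: real
    assume *: "(z, r) \<in> B" "(z', r') \<in> B" "0 \<le> t" "t \<le> 1"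
    have "(1 - t) *\<^sub>R z + t *\<^sub>R z' \<in> C"
      using * convexD_alt[OF \<open>convex C\<close>] by (simp add: B_def)
    moreover have "(1 - t) * r + t * r' \<le> (1 - t) * - (a \<bullet> (z - x)) + t * - (a \<bullet> (z' - x))"
      using * by (intro add_mono mult_left_mono) (auto simp: B_def)
    ultimately show "(1 - t) *\<^sub>R (z, r) + t *\<^sub>R (z', r') \<in> B"
      by (simp add: B_def inner_diff_right inner_add_right algebra_simps)
  qed
  moreover have "(x, 1) \<in> A" "(x, 0) \<in> B"
    using \<open>x \<in> C\<close> by (auto simp: A_def B_def)
  moreover have "A \<inter> B = {}"
    using min by (force simp: A_def B_def)
  ultimately obtain w b where w: "w \<noteq> 0" "\<forall>q\<in>B. w \<bullet> q \<le> b" "\<forall>q\<in>A. b \<le> w \<bullet> q"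
    using separating_hyperplane_sets[of B A] by blast
  obtain v s where vs: "w = (v, s)" by fastforce
  have A: "b \<le> v \<bullet> z + s * r" if "P z - P x < r" for z r
    using w(3) that by (force simp: A_def vs)
  have B: "v \<bullet> z + s * r \<le> b" if "z \<in> C" "r \<le> - (a \<bullet> (z - x))" for z r
    using w(2) that by (force simp: B_def vs)
  have "s \<ge> 0"
  proof (rule ccontr)
    assume "\<not> s \<ge> 0"
    then have "s < 0" by simp
    have "v \<bullet> x \<le> b" using B[of x 0] \<open>x \<in> C\<close> by simp
    moreover have "b \<le> v \<bullet> x + s * 1" using A[of x 1] by simp
    ultimately show False using \<open>s < 0\<close> by simp
  qed
  moreover have "s \<noteq> 0"
  proof
    assume "s = 0"
    then have le: "v \<bullet> x \<le> v \<bullet> z" for z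
      using A[of z "P z - P x + 1"] B[of x 0] \<open>x \<in> C\<close> by simp
    from le[of "x - v"] have "v \<bullet> v \<le> 0" by (simp add: inner_diff_right)
    then have "v = 0" by (metis inner_ge_zero antisym inner_eq_zero_iff)
    with \<open>s = 0\<close> vs w(1) show False by (simp add: zero_prod_def)
  qed
  ultimately have "s > 0" by simp
  have b: "b = v \<bullet> x"
  proof (rule antisym)
    show "v \<bullet> x \<le> b" using B[of x 0] \<open>x \<in> C\<close> by simp
    show "b \<le> v \<bullet> x"
    proof (rule field_le_epsilon)
      fix e :: real assume "e > 0"
      then show "b \<le> v \<bullet> x + e" using A[of x "e / s"] \<open>s > 0\<close> by simp
    qed
  qed
  define \<xi> where "\<xi> = - ((1 / s) *\<^sub>R v)"
  have "\<xi> \<in> subdiff (\<lambda>z. ereal (P z)) x"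
    unfolding subdiff_real
  proof
    fix z
    have "b \<le> v \<bullet> z + s * (P z - P x)"
    proof (rule field_le_epsilon)
      fix e :: real assume "e > 0"
      then show "b \<le> v \<bullet> z + s * (P z - P x) + e"
        using A[of z "P z - P x + e / s"] \<open>s > 0\<close> by (simp add: algebra_simps)
    qed
    then show "P x + \<xi> \<bullet> (z - x) \<le> P z"
      using \<open>s > 0\<close> b by (simp add: \<xi>_def field_simps inner_diff_right)
  qed
  moreover have "- a - \<xi> \<in> normal_cone C x"
    unfolding normal_cone_iff[OF \<open>x \<in> C\<close>]
  proof
    fix z assume "z \<in> C"
    have "s * ((- a - \<xi>) \<bullet> (z - x)) = v \<bullet> z + s * - (a \<bullet> (z - x)) - b"
      using \<open>s > 0\<close> b by (simp add: \<xi>_def inner_diff_right inner_diff_left algebra_simps)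
    with B[OF \<open>z \<in> C\<close> order_refl] have "s * ((- a - \<xi>) \<bullet> (z - x)) \<le> 0"
      by simp
    then show "(- a - \<xi>) \<bullet> (z - x) \<le> 0"
      using \<open>s > 0\<close> by (simp add: mult_le_0_iff)
  qed
  ultimately show ?thesis
    by (intro exI[of _ \<xi>] exI[of _ "- a - \<xi>"]) simp
qed

subsection \<open>Directions along a convex set\<close>

text \<open>The linear subspace parallel to the affine hull. A Lipschitz condition on \<open>C\<close> says nothing about
  the derivative across this subspace when \<open>C\<close> has empty interior, so the estimates for the
  constraint are made along it only.\<close>

definition direction_space :: "'a::euclidean_space set \<Rightarrow> 'a set"
  where "direction_space C = {y - x |x y. x \<in> affine hull C \<and> y \<in> affine hull C}"

lemma diff_in_direction_space:
  "x \<in> C \<Longrightarrow> y \<in> C \<Longrightarrow> y - x \<in> direction_space C"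
  unfolding direction_space_def by (blast intro: hull_inc)

lemma direction_space_translate:
  assumes "x \<in> C" "d \<in> direction_space C"
  shows "x + r *\<^sub>R d \<in> affine hull C"
  using assms mem_affine_3_minus[OF affine_affine_hull hull_inc[OF assms(1)]]
  by (force simp: direction_space_def)

lemma subspace_direction_space:
  assumes "x \<in> C"
  shows "subspace (direction_space C)"
proof -
  have x: "x \<in> affine hull C" using assms by (rule hull_inc)
  have "direction_space C = (\<lambda>y. - x + y) ` (affine hull C)"
  proof (intro equalityI subsetI)
    fix d assume d: "d \<in> direction_space C"
    then have "x + d \<in> affine hull C"
      using direction_space_translate[OF assms d, of 1] by simp
    then show "d \<in> (\<lambda>y. - x + y) ` (affine hull C)" by force
  next
    fix d assume "d \<in> (\<lambda>y. - x + y) ` (affine hull C)"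
    then show "d \<in> direction_space C" using x by (force simp: direction_space_def)
  qed
  then show ?thesis
    using affine_diffs_subspace[OF affine_affine_hull x] by simp
qed

text \<open>Vectors orthogonal to all directions along \<open>C\<close> are normal to \<open>C\<close> at every point, so up to the
  normal cone a vector is as small as the functional it induces on these directions.\<close>

lemma normal_cone_absorbs_orthogonal:
  assumes "x \<in> C" "B \<ge> 0"
    and bound: "\<And>d. d \<in> direction_space C \<Longrightarrow> d \<bullet> a \<le> B * norm d"
  obtains z where "norm (a - z) \<le> B" "z \<in> normal_cone C x"
proof -
  have span: "span (direction_space C) = direction_space C"
    using subspace_direction_space[OF assms(1)] by (simp add: span_eq_iff)
  obtain y z where yz: "y \<in> direction_space C" "\<And>w. w \<in> direction_space C \<Longrightarrow> orthogonal z w" "a = y + z"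
    using orthogonal_subspace_decomp_exists[of "direction_space C" a] span by metis
  have "y \<bullet> z = 0" using yz(2)[OF yz(1)] by (simp add: orthogonal_def inner_commute)
  then have "norm y * norm y \<le> B * norm y"
    using bound[OF yz(1)] by (simp add: yz(3) inner_add_right dot_square_norm power2_eq_square)
  then have "norm y \<le> B"
    using \<open>B \<ge> 0\<close> by (cases "y = 0") (auto simp: mult_le_cancel_right)
  moreover have "z \<in> normal_cone C x"
    using yz(2) diff_in_direction_space[OF assms(1)] 
    by (auto simp: normal_cone_iff[OF assms(1)] orthogonal_def)
  ultimately show thesis
    using that[of z] yz(3) by simp
qed

text \<open>The derivative bound holds at relative interior points, where a small step in any direction
  along \<open>C\<close> stays in \<open>C\<close>, and extends to \<open>C\<close> by continuity of the derivative.\<close>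

lemma lipschitz_imp_jac_bound:
  fixes F :: "'a::euclidean_space \<Rightarrow> 'b::euclidean_space"
  assumes F: "continuously_differentiable F" "M-lipschitz_on C F"
    and "convex C" "x \<in> C" and d: "d \<in> direction_space C"
  shows "norm (blinfun_apply (jac F x) d) \<le> M * norm d"
proof -
  have rel: "norm (blinfun_apply (jac F y) d) \<le> M * norm d" if y: "y \<in> rel_interior C" for y
  proof (rule field_le_epsilon)
    fix e :: real assume "e > 0"
    have pos: "norm d + 1 > 0" using norm_ge_zero[of d] by linarith
    define e' where "e' = e / (norm d + 1)"
    have "e' > 0" "e' * norm d \<le> e"
      using \<open>e > 0\<close> pos by (auto simp: e'_def field_simps)
    obtain r where "y \<in> C" "r > 0" and r: "ball y r \<inter> affine hull C \<subseteq> C"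
      using y unfolding mem_rel_interior_ball by blast
    obtain s where s: "s > 0" "\<And>z. norm (z - y) < s \<Longrightarrow>
        norm (F z - F y - blinfun_apply (jac F y) (z - y)) \<le> e' * norm (z - y)"
      using has_derivative_jac[of F y] F(1) \<open>e' > 0\<close>
      unfolding has_derivative_at_alt continuously_differentiable_def by meson
    define t where "t = min r s / 2 / (norm d + 1)"
    have "t > 0" using \<open>r > 0\<close> s pos by (simp add: t_def)
    have "t * norm d < min r s"
    proof -
      have "t * norm d \<le> t * (norm d + 1)" using \<open>t > 0\<close> by simp
      also have "\<dots> = min r s / 2" using pos by (simp add: t_def field_simps)
      also have "\<dots> < min r s" using \<open>r > 0\<close> s(1) by (auto simp: min_def)
      finally show ?thesis .
    qed
    then have "norm ((y + t *\<^sub>R d) - y) < r" "norm ((y + t *\<^sub>R d) - y) < s"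
      using \<open>t > 0\<close> by auto
    moreover from this have "y + t *\<^sub>R d \<in> C"
      using r direction_space_translate[OF \<open>y \<in> C\<close> d] by (auto simp: dist_norm)
    ultimately have "norm (F (y + t *\<^sub>R d) - F y) \<le> M * (t * norm d)"
      "norm (F (y + t *\<^sub>R d) - F y - t *\<^sub>R blinfun_apply (jac F y) d) \<le> e' * (t * norm d)"
      using lipschitz_onD[OF F(2) _ \<open>y \<in> C\<close>, of "y + t *\<^sub>R d"] s(2)[of "y + t *\<^sub>R d"] \<open>t > 0\<close>
      by (auto simp: dist_norm blinfun.scaleR_right)
    then have "norm (t *\<^sub>R blinfun_apply (jac F y) d) \<le> M * (t * norm d) + e' * (t * norm d)"
      using norm_triangle_sub[of "t *\<^sub>R blinfun_apply (jac F y) d" "F (y + t *\<^sub>R d) - F y"]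
      by (simp add: norm_minus_commute)
    then have "t * norm (blinfun_apply (jac F y) d) \<le> t * (M * norm d + e' * norm d)"
      using \<open>t > 0\<close> by (simp add: algebra_simps)
    then show "norm (blinfun_apply (jac F y) d) \<le> M * norm d + e"
      using \<open>t > 0\<close> \<open>e' * norm d \<le> e\<close> by simp
  qed
  have "x \<in> closure (rel_interior C)"
    using convex_closure_rel_interior[OF \<open>convex C\<close>] closure_subset \<open>x \<in> C\<close> by blast
  then obtain X where X: "\<And>n. X n \<in> rel_interior C" "X \<longlonglongrightarrow> x"
    unfolding closure_sequential by blast
  have "(\<lambda>n. jac F (X n)) \<longlonglongrightarrow> jac F x"
    using F(1) X(2) unfolding continuously_differentiable_def
    by (metis UNIV_I continuous_on_tendsto_compose eventually_sequentiallyI)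
  then have "(\<lambda>n. norm (blinfun_apply (jac F (X n)) d)) \<longlonglongrightarrow> norm (blinfun_apply (jac F x) d)"
    by (intro tendsto_intros)
  then show ?thesis
    by (rule LIMSEQ_le_const2) (use rel X in auto)
qed

section \<open>Smoothing approximations\<close>

lemma smoothing_approxD:
  assumes "smoothing_approx \<phi> \<Phi> a1 a2 a31 a32"
  shows "a1 \<ge> 0" "a2 > 0" "a31 + a32 > 0"
    and "\<mu> > 0 \<Longrightarrow> convex_on UNIV (\<Phi> \<mu>)"
    and "\<mu> > 0 \<Longrightarrow> \<Phi> \<mu> differentiable (at y)"
    and "\<mu> > 0 \<Longrightarrow> (a1 + a2 / \<mu>)-lipschitz_on UNIV (grad (\<Phi> \<mu>))"
    and "\<mu> > 0 \<Longrightarrow> \<phi> y - a31 * \<mu> \<le> \<Phi> \<mu> y"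
    and "\<mu> > 0 \<Longrightarrow> \<Phi> \<mu> y \<le> \<phi> y + a32 * \<mu>"
  using assms by (auto simp: smoothing_approx_def continuously_differentiable_def)

lemma smoothing_above_tangent:
  assumes "smoothing_approx \<phi> \<Phi> a1 a2 a31 a32" "\<mu> > 0"
  shows "\<Phi> \<mu> y + grad (\<Phi> \<mu>) y \<bullet> (z - y) \<le> \<Phi> \<mu> z"
  by (intro convex_on_above_tangent smoothing_approxD[OF assms(1)] assms(2))

text \<open>The tangent to the smoothing minorises it, and passing between the smoothing and the
  function costs \<open>a31 * \<mu>\<close> at the base point and \<open>a32 * \<mu>\<close> at the other one.\<close>

lemma smoothing_gradient_eps_subgradient:
  assumes "smoothing_approx \<phi> \<Phi> a1 a2 a31 a32" "\<mu> > 0"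
  shows "grad (\<Phi> \<mu>) y \<in> eps_subdiff ((a31 + a32) * \<mu>) (\<lambda>z. ereal (\<phi> z)) y"
  unfolding eps_subdiff_real
proof
  fix z
  show "\<phi> y + grad (\<Phi> \<mu>) y \<bullet> (z - y) - (a31 + a32) * \<mu> \<le> \<phi> z"
    using smoothing_above_tangent[OF assms, of y z]
      smoothing_approxD(7)[OF assms, of y] smoothing_approxD(8)[OF assms, of z]
    by (simp add: algebra_simps)
qed

lemma eps_subgradient_norm_le_lipschitz:
  assumes "M-lipschitz_on UNIV \<phi>" "\<xi> \<in> eps_subdiff e (\<lambda>z. ereal (\<phi> z)) x"
  shows "norm \<xi> \<le> M"
proof (rule eps_subgradient_norm_le[OF assms(2), of M 0])
  show "\<phi> z \<le> \<phi> x + M * norm (z - x) + 0" for z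
    using lipschitz_onD[OF assms(1), of z x] by (simp add: dist_norm abs_le_iff)
qed (rule lipschitz_on_nonneg[OF assms(1)])

lemma smoothing_gradient_norm_le:
  assumes "smoothing_approx \<phi> \<Phi> a1 a2 a31 a32" "\<mu> > 0" "M-lipschitz_on UNIV \<phi>"
  shows "norm (grad (\<Phi> \<mu>) y) \<le> M"
  using eps_subgradient_norm_le_lipschitz[OF assms(3) smoothing_gradient_eps_subgradient[OF assms(1,2)]] .

locale positive_part_smoothing =
  fixes \<phi>s :: "real \<Rightarrow> real \<Rightarrow> real" and \<phi>1 \<phi>2 \<phi>31 \<phi>32 :: real
  assumes \<phi>s: "smoothing_approx (\<lambda>s. max s 0) \<phi>s \<phi>1 \<phi>2 \<phi>31 \<phi>32"
begin

lemma above_tangent: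
  assumes "\<mu> > 0"
  shows "\<phi>s \<mu> s + deriv (\<phi>s \<mu>) s * (r - s) \<le> \<phi>s \<mu> r"
  using smoothing_above_tangent[OF \<phi>s assms, of s r] smoothing_approxD(5)[OF \<phi>s assms, of s]
  by (simp add: deriv_eq_grad)

lemma deriv_le_1:
  assumes "\<mu> > 0"
  shows "deriv (\<phi>s \<mu>) s \<le> 1"
proof -
  have "1-lipschitz_on UNIV (\<lambda>s::real. max s 0)"
    by (rule lipschitz_onI) (auto simp: dist_real_def)
  from smoothing_gradient_norm_le[OF \<phi>s assms this, of s] show ?thesis
    using deriv_eq_grad[OF smoothing_approxD(5)[OF \<phi>s assms, of s]] by simp
qed

text \<open>A negative slope would make the convex function \<open>\<phi>s \<mu>\<close> unbounded at \<open>-\<infinity>\<close>, where the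
  positive part vanishes.\<close>

lemma deriv_nonneg:
  assumes "\<mu> > 0"
  shows "0 \<le> deriv (\<phi>s \<mu>) s"
proof (rule ccontr)
  let ?d = "deriv (\<phi>s \<mu>) s"
  assume "\<not> 0 \<le> ?d"
  then have "?d < 0" by simp
  define r where "r = (\<bar>\<phi>32 * \<mu> - \<phi>s \<mu> s\<bar> + 1) / (- ?d) + \<bar>s\<bar>"
  have "(\<bar>\<phi>32 * \<mu> - \<phi>s \<mu> s\<bar> + 1) / (- ?d) \<ge> 0"
    by (rule divide_nonneg_nonneg) (use \<open>?d < 0\<close> in auto)
  then have "s - r \<le> 0" by (simp add: r_def)
  then have "\<phi>s \<mu> (s - r) \<le> \<phi>32 * \<mu>"
    using smoothing_approxD(8)[OF \<phi>s assms, of "s - r"] by simp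
  with above_tangent[OF assms, of s "s - r"] have "- ?d * r \<le> \<phi>32 * \<mu> - \<phi>s \<mu> s"
    by (simp add: algebra_simps)
  moreover have "- ?d * r = \<bar>\<phi>32 * \<mu> - \<phi>s \<mu> s\<bar> + 1 + - ?d * \<bar>s\<bar>"
    using \<open>?d < 0\<close> by (simp add: r_def field_simps)
  moreover have "- ?d * \<bar>s\<bar> \<ge> 0"
    using \<open>?d < 0\<close> by (intro mult_nonneg_nonneg) auto
  ultimately show False by linarith
qed

lemma nonexpansive:
  assumes "\<mu> > 0" "0 \<le> e" "s \<le> r + e"
  shows "\<phi>s \<mu> s \<le> \<phi>s \<mu> r + e"
proof -
  have "deriv (\<phi>s \<mu>) s * (s - r) \<le> deriv (\<phi>s \<mu>) s * e"
    using assms deriv_nonneg by (intro mult_left_mono) auto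
  also have "\<dots> \<le> 1 * e"
    using assms deriv_le_1 by (intro mult_right_mono) auto
  finally show ?thesis
    using above_tangent[OF assms(1), of s r] by (simp add: algebra_simps)
qed

text \<open>Beyond twice the smoothing error the secant from \<open>0\<close> to \<open>s\<close> has slope at least \<open>1/2\<close>, and
  convexity makes the tangent at \<open>s\<close> at least as steep.\<close>

lemma deriv_ge_half:
  assumes "\<mu> > 0" "s > 2 * (\<phi>31 + \<phi>32) * \<mu>"
  shows "1 / 2 \<le> deriv (\<phi>s \<mu>) s"
proof -
  have "0 < 2 * (\<phi>31 + \<phi>32) * \<mu>"
    using assms(1) smoothing_approxD(3)[OF \<phi>s] by simp
  then have "s > 0" using assms(2) by linarith
  have "s - \<phi>31 * \<mu> \<le> \<phi>s \<mu> s" "\<phi>s \<mu> 0 \<le> \<phi>32 * \<mu>"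
    using smoothing_approxD(7)[OF \<phi>s assms(1), of s] smoothing_approxD(8)[OF \<phi>s assms(1), of 0] \<open>s > 0\<close>
    by auto
  with above_tangent[OF assms(1), of s 0] have "s - (\<phi>31 + \<phi>32) * \<mu> \<le> deriv (\<phi>s \<mu>) s * s"
    by (simp add: algebra_simps)
  then have "1 / 2 * s \<le> deriv (\<phi>s \<mu>) s * s"
    using assms(2) by linarith
  then show ?thesis
    using \<open>s > 0\<close> by (simp add: mult_le_cancel_right)
qed

lemma deriv_times_negative_le:
  assumes "\<mu> > 0" "s \<le> 0"
  shows "deriv (\<phi>s \<mu>) s * - s \<le> (\<phi>31 + \<phi>32) * \<mu>"
  using above_tangent[OF assms(1), of s 0] smoothing_approxD(7)[OF \<phi>s assms(1), of s]
    smoothing_approxD(8)[OF \<phi>s assms(1), of 0] assms(2)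
  by (simp add: algebra_simps max_def split: if_splits)

end

section \<open>The constraint qualification gives a uniform bound\<close>

text \<open>The convex subgradient inequality along \<open>c\<close>, combined with the first-order expansion of \<open>c\<close>,
  gives the inequality that defines a regular subgradient of the composition.\<close>

lemma chain_rule_subgradient_regular:
  assumes u: "u \<in> subdiff (\<lambda>y. ereal (h y)) (c x)"
    and c: "c differentiable (at x)"
  shows "adjoint (blinfun_apply (jac c x)) u \<in> regular_subdiff (\<lambda>x. h (c x)) x"
proof -
  let ?v = "adjoint (blinfun_apply (jac c x)) u"
  let ?q = "\<lambda>y. (h (c y) - h (c x) - ?v \<bullet> (y - x)) / norm (y - x)"
  have "ereal r \<le> Liminf (at x) (\<lambda>y. ereal (?q y))" if "r < 0" for r
  proof (rule Liminf_bounded)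
    define e where "e = - r / (norm u + 1)"
    have pos: "norm u + 1 > 0" using norm_ge_zero[of u] by linarith
    then have "e > 0" using that by (simp add: e_def divide_neg_pos)
    have "e * norm u \<le> - r"
    proof -
      have "e * norm u \<le> e * (norm u + 1)" using \<open>e > 0\<close> by simp
      also have "\<dots> = - r" using pos by (simp add: e_def)
      finally show ?thesis .
    qed
    obtain d where d: "d > 0" "\<And>y. norm (y - x) < d \<Longrightarrow>
        norm (c y - c x - blinfun_apply (jac c x) (y - x)) \<le> e * norm (y - x)"
      using has_derivative_jac[OF c] \<open>e > 0\<close> unfolding has_derivative_at_alt by meson
    have "r \<le> ?q y" if "y \<noteq> x" "norm (y - x) < d" for y
    proof -
      let ?R = "c y - c x - blinfun_apply (jac c x) (y - x)"
      have "u \<bullet> (c y - c x) \<le> h (c y) - h (c x)"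
        using u[unfolded subdiff_real, rule_format, of "c y"] by simp
      moreover have "u \<bullet> (c y - c x) = ?v \<bullet> (y - x) + u \<bullet> ?R"
        using adjoint_blinfun[of "y - x" "jac c x" u] by (simp add: inner_diff_right inner_commute)
      moreover have "\<bar>u \<bullet> ?R\<bar> \<le> norm u * (e * norm (y - x))"
        using Cauchy_Schwarz_ineq2[of u ?R] d(2)[OF that(2)]
        by (meson mult_left_mono norm_ge_zero order_trans)
      moreover have "norm u * (e * norm (y - x)) \<le> - r * norm (y - x)"
        using mult_right_mono[OF \<open>e * norm u \<le> - r\<close>, of "norm (y - x)"] by (simp add: mult_ac)
      ultimately have "r * norm (y - x) \<le> h (c y) - h (c x) - ?v \<bullet> (y - x)"
        by linarith
      then show ?thesis
        using that(1) by (simp add: pos_le_divide_eq)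
    qed
    then show "\<forall>\<^sub>F y in at x. ereal r \<le> ereal (?q y)"
      unfolding eventually_at by (intro exI[of _ d]) (use d(1) in \<open>auto simp: dist_norm\<close>)
  qed
  then have "0 \<le> Liminf (at x) (\<lambda>y. ereal (?q y))"
  proof -
    assume *: "\<And>r. r < 0 \<Longrightarrow> ereal r \<le> Liminf (at x) (\<lambda>y. ereal (?q y))"
    show ?thesis
    proof (rule dense_le)
      fix z :: ereal assume "z < 0"
      then show "z \<le> Liminf (at x) (\<lambda>y. ereal (?q y))"
        using * by (cases z) auto
    qed
  qed
  then show ?thesis
    unfolding regular_subdiff_def by simp
qed

lemma regular_subdiff_subset_limiting:
  "regular_subdiff \<phi> x \<subseteq> limiting_subdiff \<phi> x"
proof
  fix v assume "v \<in> regular_subdiff \<phi> x"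
  then show "v \<in> limiting_subdiff \<phi> x"
    unfolding limiting_subdiff_def
    by (intro CollectI exI[of _ "\<lambda>_. x"] exI[of _ "\<lambda>_. v"]) simp
qed

text \<open>If no uniform bound existed, there would be points of \<open>C\<close>, approximate subgradients of \<open>h\<close>
  and normal vectors whose combination tends to zero. Along a subsequence the points converge because \<open>C\<close> is compact, and
  the subgradients because \<open>h\<close> is Lipschitz; the limits violate the qualification.\<close>

lemma CQ_imp_CQ_constant:
  fixes c :: "'a::euclidean_space \<Rightarrow> 'b::euclidean_space"
  assumes "compact C"
    and c: "continuously_differentiable c"
    and h: "M-lipschitz_on UNIV h"
    and CQ: "CQ C (\<lambda>x. h (c x))"
  shows "\<exists>\<eta>. CQ_constant C c h \<eta>"
proof (rule ccontr)
  assume none: "\<nexists>\<eta>. CQ_constant C c h \<eta>"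
  have cdiff: "c differentiable (at x)" for x
    using c by (simp add: continuously_differentiable_def)
  define e where "e = (\<lambda>k. inverse (real (Suc k)))"
  have e: "e k > 0" for k by (simp add: e_def)
  have "e \<longlonglongrightarrow> 0" unfolding e_def by (rule LIMSEQ_inverse_real_of_nat)
  (* Failure of the candidate constant e k yields the kth element of the sequences. *)
  have "\<exists>x u n. x \<in> C \<and> h (c x) \<ge> - e k \<and> u \<in> eps_subdiff (e k) (\<lambda>y. ereal (h y)) (c x) \<and>
      n \<in> normal_cone C x \<and> norm (adjoint (blinfun_apply (jac c x)) u + n) < e k" for k
  proof -
    obtain x u where xu: "x \<in> C" "h (c x) \<ge> - e k" "u \<in> eps_subdiff (e k) (\<lambda>y. ereal (h y)) (c x)"
      and lt: "infdist 0 {adjoint (blinfun_apply (jac c x)) u + n |n. n \<in> normal_cone C x} < e k"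
      (is "infdist 0 ?S < _")
      using none e[of k] unfolding CQ_constant_def by (meson not_le)
    have "0 \<in> normal_cone C x" using xu by (simp add: normal_cone_iff)
    then have "?S \<noteq> {}" by blast
    then obtain v where "v \<in> ?S" "dist 0 v < e k"
      using infdist_le2 lt by (metis (no_types, lifting) cINF_less_iff bdd_below_image_dist infdist_notempty)
    then show ?thesis using xu by (auto simp: dist_norm)
  qed
  then obtain X U N where
    X: "X k \<in> C" "h (c (X k)) \<ge> - e k"
    and U: "U k \<in> eps_subdiff (e k) (\<lambda>y. ereal (h y)) (c (X k))"
    and N: "N k \<in> normal_cone C (X k)"
      "norm (adjoint (blinfun_apply (jac c (X k))) (U k) + N k) < e k" for k
    by metis
  obtain x r where r: "x \<in> C" "strict_mono r" "(X \<circ> r) \<longlonglongrightarrow> x"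
    using \<open>compact C\<close> X(1) unfolding compact_def by metis
  have "U k \<in> cball 0 M" for k
    using eps_subgradient_norm_le_lipschitz[OF h U] by (simp add: dist_norm)
  then have "\<forall>k. (U \<circ> r) k \<in> cball 0 M" by simp
  then obtain u r' where r': "strict_mono r'" "((U \<circ> r) \<circ> r') \<longlonglongrightarrow> u"
    using compact_cball[of 0 M] unfolding compact_def by metis
  define s where "s = r \<circ> r'"
  have s: "strict_mono s" using r r' by (simp add: s_def strict_mono_o)
  have xlim: "(\<lambda>k. X (s k)) \<longlonglongrightarrow> x"
    using LIMSEQ_subseq_LIMSEQ[OF r(3) r'(1)] by (simp add: s_def o_def)
  have ulim: "(\<lambda>k. U (s k)) \<longlonglongrightarrow> u"
    using r'(2) by (simp add: s_def o_def)
  have elim: "(\<lambda>k. e (s k)) \<longlonglongrightarrow> 0"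
    using LIMSEQ_subseq_LIMSEQ[OF \<open>e \<longlonglongrightarrow> 0\<close> s] by (simp add: o_def)
  have climit: "(\<lambda>k. c (X (s k))) \<longlonglongrightarrow> c x"
    using isCont_tendsto_compose[OF differentiable_imp_continuous_within[OF cdiff] xlim] .
  have hcont: "isCont h y" for y
    using lipschitz_on_continuous_on[OF h] by (simp add: continuous_on_eq_continuous_at)
  have hlim: "(\<lambda>k. h (c (X (s k)))) \<longlonglongrightarrow> h (c x)"
    using isCont_tendsto_compose[OF hcont climit] .
  have jlim: "(\<lambda>k. jac c (X (s k))) \<longlonglongrightarrow> jac c x"
    using c xlim unfolding continuously_differentiable_def
    by (metis UNIV_I continuous_on_tendsto_compose eventually_sequentiallyI)
  let ?v = "adjoint (blinfun_apply (jac c x)) u"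
  have "h (c x) \<ge> 0"
    using LIMSEQ_le[OF tendsto_minus[OF elim] hlim] X(2) by auto
  moreover have usub: "u \<in> subdiff (\<lambda>y. ereal (h y)) (c x)"
    unfolding subdiff_real
  proof
    fix z
    have "(\<lambda>k. h (c (X (s k))) + U (s k) \<bullet> (z - c (X (s k))) - e (s k)) \<longlonglongrightarrow> h (c x) + u \<bullet> (z - c x) - 0"
      by (intro tendsto_intros hlim ulim climit elim)
    then show "h (c x) + u \<bullet> (z - c x) \<le> h z"
      using U by (intro LIMSEQ_le_const2[where X = "\<lambda>k. h (c (X (s k))) + U (s k) \<bullet> (z - c (X (s k))) - e (s k)"])
        (auto simp: eps_subdiff_real)
  qed
  moreover have "- ?v \<in> normal_cone C x"
    unfolding normal_cone_iff[OF \<open>x \<in> C\<close>]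
  proof
    fix z assume "z \<in> C"
    define d where "d = (\<lambda>k. z - X (s k))"
    have dlim: "d \<longlonglongrightarrow> z - x"
      unfolding d_def by (intro tendsto_intros xlim)
    have ge: "- (e (s k) * norm (d k)) \<le> blinfun_apply (jac c (X (s k))) (d k) \<bullet> U (s k)" for k
    proof -
      let ?w = "adjoint (blinfun_apply (jac c (X (s k)))) (U (s k))"
      have "- ((?w + N (s k)) \<bullet> d k) \<le> norm (?w + N (s k)) * norm (d k)"
        using Cauchy_Schwarz_ineq2[of "?w + N (s k)" "d k"] by linarith
      also have "\<dots> \<le> e (s k) * norm (d k)"
        using N(2)[of "s k"] by (intro mult_right_mono) auto
      finally have "- (?w \<bullet> d k) - N (s k) \<bullet> d k \<le> e (s k) * norm (d k)"
        by (simp add: inner_add_left)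
      moreover have "N (s k) \<bullet> d k \<le> 0"
        using N(1)[of "s k"] \<open>z \<in> C\<close> X(1) by (simp add: normal_cone_iff d_def)
      ultimately show ?thesis
        using adjoint_blinfun[of "d k" "jac c (X (s k))" "U (s k)"] by (simp add: inner_commute)
    qed
    have "(\<lambda>k. - (e (s k) * norm (d k))) \<longlonglongrightarrow> - (0 * norm (z - x))"
      by (intro tendsto_intros elim dlim)
    moreover have "(\<lambda>k. blinfun_apply (jac c (X (s k))) (d k) \<bullet> U (s k)) \<longlonglongrightarrow> blinfun_apply (jac c x) (z - x) \<bullet> u"
      by (intro tendsto_intros jlim dlim ulim)
    ultimately have "0 \<le> blinfun_apply (jac c x) (z - x) \<bullet> u"
      using LIMSEQ_le ge by fastforce
    then show "- ?v \<bullet> (z - x) \<le> 0"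
      using adjoint_blinfun[of "z - x" "jac c x" u] by (simp add: inner_commute)
  qed
  moreover have "?v \<in> limiting_subdiff (\<lambda>x. h (c x)) x"
    using chain_rule_subgradient_regular[OF usub cdiff] regular_subdiff_subset_limiting by blast
  moreover have "0 = ?v + - ?v" by simp
  ultimately show False
    using CQ \<open>x \<in> C\<close> unfolding CQ_def by blast
qed

lemma CQ_constantD:
  assumes "CQ_constant C c h \<eta>" "x \<in> C" "- \<eta> \<le> h (c x)"
    "u \<in> eps_subdiff \<eta> (\<lambda>y. ereal (h y)) (c x)" "n \<in> normal_cone C x"
  shows "\<eta> \<le> norm (adjoint (blinfun_apply (jac c x)) u + n)"
proof -
  let ?S = "{adjoint (blinfun_apply (jac c x)) u + n |n. n \<in> normal_cone C x}"
  have "\<eta> \<le> infdist 0 ?S"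
    using assms unfolding CQ_constant_def by blast
  also have "\<dots> \<le> dist 0 (adjoint (blinfun_apply (jac c x)) u + n)"
    by (rule infdist_le) (use assms in blast)
  finally show ?thesis by simp
qed

section \<open>The smoothed constraint function\<close>

locale smoothed_composite = positive_part_smoothing \<phi>s \<phi>1 \<phi>2 \<phi>31 \<phi>32
  for \<phi>s :: "real \<Rightarrow> real \<Rightarrow> real" and \<phi>1 \<phi>2 \<phi>31 \<phi>32 +
  fixes C :: "'a::euclidean_space set"
    and c :: "'a \<Rightarrow> 'b::euclidean_space"
    and h :: "'b \<Rightarrow> real"
    and hs :: "real \<Rightarrow> 'b \<Rightarrow> real"
    and Lc Mc Mh h1 h2 h31 h32 :: real
  assumes convex_C: "convex C"
    and c: "continuously_differentiable c" "smooth_on_set Lc C c" "Mc-lipschitz_on C c"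
    and h: "Mh-lipschitz_on UNIV h"
    and hs: "smoothing_approx h hs h1 h2 h31 h32"
begin

abbreviation G :: "real \<Rightarrow> 'a \<Rightarrow> real"
  where "G \<equiv> smoothed_constraint \<phi>s hs c"

definition L_G :: "real \<Rightarrow> real"
  where "L_G m = Mh * Lc + (h1 + Mh\<^sup>2 * \<phi>1) * Mc\<^sup>2 + (h2 + Mh\<^sup>2 * \<phi>2) * Mc\<^sup>2 / m"

abbreviation slope :: "real \<Rightarrow> 'b \<Rightarrow> real"
  where "slope m y \<equiv> deriv (\<phi>s m) (hs m y)"

abbreviation outer_grad :: "real \<Rightarrow> 'b \<Rightarrow> 'b"
  where "outer_grad m y \<equiv> slope m y *\<^sub>R grad (hs m) y"

lemma constants_nonneg: "0 \<le> Mh" "0 \<le> Lc" "0 \<le> Mc"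
  using lipschitz_on_nonneg h c unfolding smooth_on_set_def by blast+

lemma L_G_nonneg: "m > 0 \<Longrightarrow> 0 \<le> L_G m"
  unfolding L_G_def
  using smoothing_approxD(1,2)[OF hs] smoothing_approxD(1,2)[OF \<phi>s] constants_nonneg by auto

lemma mult_L_G_mono:
  assumes "0 < m" "m \<le> m'"
  shows "m * L_G m \<le> m' * L_G m'"
proof -
  have "m * (Mh * Lc + (h1 + Mh\<^sup>2 * \<phi>1) * Mc\<^sup>2) \<le> m' * (Mh * Lc + (h1 + Mh\<^sup>2 * \<phi>1) * Mc\<^sup>2)"
    using assms smoothing_approxD(1)[OF hs] smoothing_approxD(1)[OF \<phi>s] constants_nonneg
    by (intro mult_right_mono) auto
  then show ?thesis
    using assms by (simp add: L_G_def distrib_left)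
qed

lemma hs_lipschitz:
  assumes "m > 0"
  shows "\<bar>hs m y - hs m z\<bar> \<le> Mh * norm (y - z)"
proof -
  have "hs m y - hs m z \<le> Mh * norm (y - z)" for y z
  proof -
    have "grad (hs m) y \<bullet> (y - z) \<le> norm (grad (hs m) y) * norm (y - z)"
      by (rule norm_cauchy_schwarz)
    also have "\<dots> \<le> Mh * norm (y - z)"
      by (intro mult_right_mono smoothing_gradient_norm_le[OF hs assms h]) simp
    finally show ?thesis
      using smoothing_above_tangent[OF hs assms, of y z] by (simp add: inner_diff_right)
  qed
  from this[of y z] this[of z y] show ?thesis
    by (simp add: norm_minus_commute abs_le_iff)
qed

text \<open>The two terms of the constants come from the two factors of the gradient: the gradient of the
  smoothed \<open>h\<close> varies while the slope is at most \<open>1\<close>, and the slope varies while the gradient is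
  at most \<open>Mh\<close>; in the second case the argument of the slope itself moves at rate \<open>Mh\<close>.\<close>

lemma outer_grad_lipschitz:
  assumes "m > 0"
  shows "norm (outer_grad m y - outer_grad m z)
    \<le> ((h1 + Mh\<^sup>2 * \<phi>1) + (h2 + Mh\<^sup>2 * \<phi>2) / m) * norm (y - z)"
proof -
  note pos = smoothing_approxD(1,2)[OF \<phi>s] smoothing_approxD(1,2)[OF hs] constants_nonneg
  have 1: "\<bar>slope m y\<bar> * norm (grad (hs m) y - grad (hs m) z) \<le> 1 * ((h1 + h2 / m) * norm (y - z))"
    using deriv_nonneg[OF assms] deriv_le_1[OF assms]
      lipschitz_onD[OF smoothing_approxD(6)[OF hs assms], of y z]
    by (intro mult_mono) (auto simp: dist_norm)
  have 2: "\<bar>slope m y - slope m z\<bar> * norm (grad (hs m) z)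
      \<le> ((\<phi>1 + \<phi>2 / m) * (Mh * norm (y - z))) * Mh"
  proof (intro mult_mono smoothing_gradient_norm_le[OF hs assms h])
    have "\<bar>slope m y - slope m z\<bar> \<le> (\<phi>1 + \<phi>2 / m) * \<bar>hs m y - hs m z\<bar>"
      using lipschitz_onD[OF smoothing_approxD(6)[OF \<phi>s assms], of "hs m y" "hs m z"]
      by (simp add: dist_real_def deriv_eq_grad smoothing_approxD(5)[OF \<phi>s assms])
    also have "\<dots> \<le> (\<phi>1 + \<phi>2 / m) * (Mh * norm (y - z))"
      using hs_lipschitz[OF assms] pos assms by (intro mult_left_mono) auto
    finally show "\<bar>slope m y - slope m z\<bar> \<le> (\<phi>1 + \<phi>2 / m) * (Mh * norm (y - z))" .
    show "0 \<le> (\<phi>1 + \<phi>2 / m) * (Mh * norm (y - z))"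
      using pos assms by (intro mult_nonneg_nonneg) auto
  qed simp
  have "outer_grad m y - outer_grad m z
      = slope m y *\<^sub>R (grad (hs m) y - grad (hs m) z) + (slope m y - slope m z) *\<^sub>R grad (hs m) z"
    by (simp add: algebra_simps)
  then have "norm (outer_grad m y - outer_grad m z)
      \<le> \<bar>slope m y\<bar> * norm (grad (hs m) y - grad (hs m) z) + \<bar>slope m y - slope m z\<bar> * norm (grad (hs m) z)"
    using norm_triangle_ineq[of "slope m y *\<^sub>R (grad (hs m) y - grad (hs m) z)"
        "(slope m y - slope m z) *\<^sub>R grad (hs m) z"] by simp
  also have "\<dots> \<le> 1 * ((h1 + h2 / m) * norm (y - z)) + ((\<phi>1 + \<phi>2 / m) * (Mh * norm (y - z))) * Mh"
    using 1 2 by (rule add_mono)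
  also have "\<dots> = ((h1 + Mh\<^sup>2 * \<phi>1) + (h2 + Mh\<^sup>2 * \<phi>2) / m) * norm (y - z)"
    using assms by (simp add: field_simps power2_eq_square)
  finally show ?thesis .
qed

lemma outer_grad_norm_le:
  assumes "m > 0"
  shows "norm (outer_grad m y) \<le> Mh"
proof -
  have "norm (outer_grad m y) \<le> 1 * Mh"
    unfolding norm_scaleR using deriv_nonneg[OF assms] deriv_le_1[OF assms]
    by (intro mult_mono smoothing_gradient_norm_le[OF hs assms h]) auto
  then show ?thesis by simp
qed

lemma c_differentiable: "c differentiable (at x)"
  using c(1) by (simp add: continuously_differentiable_def)

lemma GDERIV_G:
  assumes "m > 0"
  shows "GDERIV (G m) x :> adjoint (blinfun_apply (jac c x)) (outer_grad m (c x))"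
proof -
  have 1: "((\<lambda>x. hs m (c x)) has_derivative (\<lambda>d. blinfun_apply (jac c x) d \<bullet> grad (hs m) (c x))) (at x)"
    using has_derivative_compose[OF has_derivative_jac[OF c_differentiable]
        GDERIV_grad[OF smoothing_approxD(5)[OF hs assms], unfolded gderiv_def]] .
  have "(\<phi>s m has_derivative (\<lambda>r. slope m (c x) * r)) (at (hs m (c x)))"
    using GDERIV_grad[OF smoothing_approxD(5)[OF \<phi>s assms], of "hs m (c x)"]
    by (simp add: has_field_derivative_def deriv_eq_grad smoothing_approxD(5)[OF \<phi>s assms])
  from has_derivative_compose[OF 1 this] show ?thesis
    unfolding gderiv_def smoothed_constraint_def by (simp add: adjoint_blinfun)
qed

lemma grad_G:
  "m > 0 \<Longrightarrow> grad (G m) x = adjoint (blinfun_apply (jac c x)) (outer_grad m (c x))"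
  by (rule grad_eqI[OF GDERIV_G])

lemma G_differentiable: "m > 0 \<Longrightarrow> G m differentiable (at x)"
  using GDERIV_G[of m x] unfolding gderiv_def differentiable_def by blast

text \<open>Only directions along \<open>C\<close> are tested, since that is where the derivative of \<open>c\<close> is bounded
  by \<open>Mc\<close>.\<close>

lemma grad_G_lipschitz_along:
  assumes "m > 0" "x \<in> C" "y \<in> C" "d \<in> direction_space C"
  shows "d \<bullet> (grad (G m) x - grad (G m) y) \<le> L_G m * norm (x - y) * norm d"
proof -
  note pos = smoothing_approxD(1,2)[OF \<phi>s] smoothing_approxD(1,2)[OF hs] constants_nonneg
  let ?W = "\<lambda>x. outer_grad m (c x)" and ?J = "\<lambda>x. blinfun_apply (jac c x)"
  let ?a = "(h1 + Mh\<^sup>2 * \<phi>1) + (h2 + Mh\<^sup>2 * \<phi>2) / m"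
  have a: "0 \<le> ?a" using pos assms(1) by auto
  have "d \<bullet> (grad (G m) x - grad (G m) y) = ?J x d \<bullet> ?W x - ?J y d \<bullet> ?W y"
    by (simp only: inner_diff_right grad_G[OF assms(1)] adjoint_blinfun)
  also have "\<dots> = blinfun_apply (jac c x - jac c y) d \<bullet> ?W x + ?J y d \<bullet> (?W x - ?W y)"
    by (simp only: inner_diff_right inner_diff_left blinfun.diff_left)
  also have "\<dots> \<le> norm (blinfun_apply (jac c x - jac c y) d) * norm (?W x)
      + norm (?J y d) * norm (?W x - ?W y)"
    by (intro add_mono norm_cauchy_schwarz)
  also have "\<dots> \<le> (Lc * norm (x - y) * norm d) * Mh + (Mc * norm d) * (?a * (Mc * norm (x - y)))"
  proof (intro add_mono mult_mono outer_grad_norm_le[OF assms(1)])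
    have "norm (blinfun_apply (jac c x - jac c y) d) \<le> norm (jac c x - jac c y) * norm d"
      by (rule norm_blinfun)
    also have "\<dots> \<le> Lc * norm (x - y) * norm d"
      using lipschitz_onD[OF c(2)[unfolded smooth_on_set_def] assms(2,3)]
      by (intro mult_right_mono) (auto simp: dist_norm)
    finally show "norm (blinfun_apply (jac c x - jac c y) d) \<le> Lc * norm (x - y) * norm d" .
    show "norm (?J y d) \<le> Mc * norm d"
      by (rule lipschitz_imp_jac_bound[OF c(1) c(3) convex_C assms(3,4)])
    have "norm (?W x - ?W y) \<le> ?a * norm (c x - c y)"
      by (rule outer_grad_lipschitz[OF assms(1)])
    also have "\<dots> \<le> ?a * (Mc * norm (x - y))"
      using lipschitz_onD[OF c(3) assms(2,3)] a by (intro mult_left_mono) (auto simp: dist_norm)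
    finally show "norm (?W x - ?W y) \<le> ?a * (Mc * norm (x - y))" .
  qed (use pos in auto)
  also have "\<dots> = L_G m * norm (x - y) * norm d"
    using assms(1) by (simp add: L_G_def field_simps power2_eq_square)
  finally show ?thesis .
qed

lemma G_descent:
  assumes "m > 0" "x \<in> C" "y \<in> C"
  shows "G m y \<le> G m x + grad (G m) x \<bullet> (y - x) + L_G m / 2 * (norm (y - x))\<^sup>2"
  using assms by (intro descent_lemma[OF _ convex_C] G_differentiable grad_G_lipschitz_along
      diff_in_direction_space)

lemma G_ge: "m > 0 \<Longrightarrow> - \<phi>31 * m \<le> G m x"
  using smoothing_approxD(7)[OF \<phi>s, of m "hs m (c x)"] by (simp add: smoothed_constraint_def)

lemma G_monotone:
  assumes "smoothing_monotone hs h4" "smoothing_monotone \<phi>s \<phi>4" "0 < m" "m \<le> m'"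
  shows "G m x \<le> G m' x + (h4 + \<phi>4) * (m' - m)"
proof -
  have "hs m (c x) \<le> hs m' (c x) + h4 * (m' - m)" "0 \<le> h4 * (m' - m)"
    using assms by (auto simp: smoothing_monotone_def)
  from nonexpansive[OF \<open>0 < m\<close> this(2,1)]
  have "\<phi>s m (hs m (c x)) \<le> \<phi>s m (hs m' (c x)) + h4 * (m' - m)" .
  moreover have "\<phi>s m (hs m' (c x)) \<le> \<phi>s m' (hs m' (c x)) + \<phi>4 * (m' - m)"
    using assms by (auto simp: smoothing_monotone_def)
  ultimately show ?thesis
    by (simp add: smoothed_constraint_def algebra_simps)
qed

end

section \<open>One iteration of the algorithm\<close>

text \<open>This extracts the first-order optimality condition from minimality along a segment.\<close>

lemma minimizer_quadratic_perturbation: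
  fixes A B :: real
  assumes "\<And>t. 0 < t \<Longrightarrow> t \<le> 1 \<Longrightarrow> 0 \<le> t * A + t\<^sup>2 * B"
  shows "0 \<le> A"
proof (rule ccontr)
  assume "\<not> 0 \<le> A"
  then have "A < 0" by simp
  define t where "t = min 1 (- A / (2 * (\<bar>B\<bar> + 1)))"
  have "0 < - A / (2 * (\<bar>B\<bar> + 1))"
    by (rule divide_pos_pos) (use \<open>A < 0\<close> in auto)
  then have t: "0 < t" "t \<le> 1" by (auto simp: t_def)
  have "t * (2 * (\<bar>B\<bar> + 1)) \<le> - A"
    unfolding t_def by (subst pos_le_divide_eq[symmetric]) auto
  moreover have "0 \<le> t * (A + t * B)"
    using assms[OF t] by (simp add: algebra_simps power2_eq_square)
  then have "0 \<le> A + t * B" using t by (simp add: zero_le_mult_iff)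
  moreover have "t * B \<le> t * (\<bar>B\<bar> + 1)"
    using t by (intro mult_left_mono) auto
  ultimately show False using \<open>A < 0\<close> by (simp add: algebra_simps)
qed

lemma subproblem_solution:
  assumes min: "is_arg_min (subproblem f P1 C G \<gamma> \<mu> xk \<zeta> L) (\<lambda>_. True) y"
    and "convex C" "xk \<in> C" and P1: "convex_on UNIV P1" and "0 \<le> \<gamma>"
  shows "y \<in> C"
    and "z \<in> C \<Longrightarrow> 0 \<le> \<gamma> * ((grad f xk - \<zeta>) \<bullet> (z - y) + P1 z - P1 y) + grad G xk \<bullet> (z - y)
      + L / \<mu> * ((y - xk) \<bullet> (z - y))"
proof -
  let ?Q = "\<lambda>x. \<gamma> * ((grad f xk - \<zeta>) \<bullet> x + P1 x) + (G xk + grad G xk \<bullet> (x - xk))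
    + L / (2 * \<mu>) * (norm (x - xk))\<^sup>2"
  have le: "subproblem f P1 C G \<gamma> \<mu> xk \<zeta> L y \<le> subproblem f P1 C G \<gamma> \<mu> xk \<zeta> L z" for z
    using min by (auto simp: is_arg_min_def not_less)
  show "y \<in> C"
    using le[of xk] \<open>xk \<in> C\<close> by (auto simp: subproblem_def delta_def split: if_splits)
  then have Q: "?Q y \<le> ?Q z" if "z \<in> C" for z
    using le[of z] that by (simp add: subproblem_def delta_def)
  show "0 \<le> \<gamma> * ((grad f xk - \<zeta>) \<bullet> (z - y) + P1 z - P1 y) + grad G xk \<bullet> (z - y)
      + L / \<mu> * ((y - xk) \<bullet> (z - y))" if "z \<in> C"
  proof (rule minimizer_quadratic_perturbation)
    fix t :: real assume t: "0 < t" "t \<le> 1"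
    define q where "q = y + t *\<^sub>R (z - y)"
    define w where "w = grad f xk - \<zeta>"
    have q: "q = (1 - t) *\<^sub>R y + t *\<^sub>R z" by (simp add: q_def algebra_simps)
    then have "q \<in> C" using t \<open>y \<in> C\<close> that convexD_alt[OF \<open>convex C\<close>] by simp
    have "P1 q \<le> (1 - t) * P1 y + t * P1 z"
      unfolding q using P1 t by (intro convex_onD) auto
    then have "\<gamma> * (P1 q - P1 y) \<le> \<gamma> * (t * (P1 z - P1 y))"
      using \<open>0 \<le> \<gamma>\<close> by (intro mult_left_mono) (auto simp: algebra_simps)
    moreover have "w \<bullet> q = w \<bullet> y + t * (w \<bullet> (z - y))"
      by (simp add: q_def inner_add_right)
    moreover have "grad G xk \<bullet> (q - xk) = grad G xk \<bullet> (y - xk) + t * (grad G xk \<bullet> (z - y))"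
      by (simp add: q_def inner_add_right inner_diff_right)
    moreover have "(norm (q - xk))\<^sup>2
        = (norm (y - xk))\<^sup>2 + 2 * t * ((y - xk) \<bullet> (z - y)) + t\<^sup>2 * (norm (z - y))\<^sup>2"
    proof -
      have "q - xk = (y - xk) + t *\<^sub>R (z - y)" by (simp add: q_def)
      then show ?thesis
        by (simp only: power2_norm_eq_inner)
          (simp add: inner_add_left inner_add_right inner_commute power2_eq_square algebra_simps)
    qed
    moreover have "?Q y \<le> ?Q q" by (rule Q[OF \<open>q \<in> C\<close>])
    moreover have "L / (2 * \<mu>) = L / \<mu> / 2" by simp
    ultimately have "0 \<le> \<gamma> * (t * (w \<bullet> (z - y))) + \<gamma> * (t * (P1 z - P1 y)) + t * (grad G xk \<bullet> (z - y))
        + L / \<mu> / 2 * (2 * t * ((y - xk) \<bullet> (z - y)) + t\<^sup>2 * (norm (z - y))\<^sup>2)"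
      unfolding w_def[symmetric] by (simp only: distrib_left right_diff_distrib)
    also have "\<dots> = t * (\<gamma> * (w \<bullet> (z - y) + P1 z - P1 y) + grad G xk \<bullet> (z - y)
      + L / \<mu> * ((y - xk) \<bullet> (z - y))) + t\<^sup>2 * (L / (2 * \<mu>) * (norm (z - y))\<^sup>2)"
    proof -
      have half: "L / (2 * \<mu>) = L / \<mu> / 2" by simp
      have "\<gamma> * (t * a) + \<gamma> * (t * p) + t * g + k / 2 * (2 * t * D + t\<^sup>2 * N)
          = t * (\<gamma> * (a + p) + g + k * D) + t\<^sup>2 * (k / 2 * N)" for a p g k D N :: real
        by (simp add: field_simps)
      from this[of "w \<bullet> (z - y)" "P1 z - P1 y" "grad G xk \<bullet> (z - y)" "L / \<mu>"
          "(y - xk) \<bullet> (z - y)" "(norm (z - y))\<^sup>2"]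
      show ?thesis by (simp only: half add_diff_eq)
    qed
    finally show "0 \<le> t * (\<gamma> * ((grad f xk - \<zeta>) \<bullet> (z - y) + P1 z - P1 y) + grad G xk \<bullet> (z - y)
      + L / \<mu> * ((y - xk) \<bullet> (z - y))) + t\<^sup>2 * (L / (2 * \<mu>) * (norm (z - y))\<^sup>2)"
      unfolding w_def .
  qed
qed

lemma sufficient_decrease_iff:
  assumes "y \<in> C" "xk \<in> C"
  shows "sufficient_decrease (objective f P1 P2 C) G c1 \<gamma> \<mu> xk y \<longleftrightarrow>
    \<gamma> * (f y + P1 y - P2 y) + G y
      \<le> \<gamma> * (f xk + P1 xk - P2 xk) + G xk - c1 / (2 * \<mu>) * (norm (y - xk))\<^sup>2"
  using assms by (simp add: sufficient_decrease_def objective_def delta_def)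

text \<open>A trial point minimises a function that is strongly convex with modulus \<open>L / \<mu>\<close>, which
  doubles the quadratic gain; the two descent lemmas and the subgradient inequality for \<open>P2\<close> pay
  for the linearisations.\<close>

lemma trial_point_decrease:
  assumes min: "is_arg_min (subproblem f P1 C G \<gamma> \<mu> xk \<zeta> L) (\<lambda>_. True) y"
    and C: "convex C" "xk \<in> C" and P1: "convex_on UNIV P1" and "0 \<le> \<gamma>"
    and f: "continuously_differentiable f" "smooth_on_set Lf C f"
    and G: "\<And>x y. x \<in> C \<Longrightarrow> y \<in> C \<Longrightarrow> G y \<le> G x + grad G x \<bullet> (y - x) + Lg / 2 * (norm (y - x))\<^sup>2"
    and \<zeta>: "\<zeta> \<in> subdiff (\<lambda>x. ereal (P2 x)) xk"
  shows "\<gamma> * (f y + P1 y - P2 y) + G y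
    \<le> \<gamma> * (f xk + P1 xk - P2 xk) + G xk + ((\<gamma> * Lf + Lg) / 2 - L / \<mu>) * (norm (y - xk))\<^sup>2"
proof -
  note sol = subproblem_solution[OF min C P1 \<open>0 \<le> \<gamma>\<close>]
  have "Lf-lipschitz_on C (grad f)"
    using f by (intro grad_lipschitz_on) (auto simp: continuously_differentiable_def smooth_on_set_def)
  then have "(y - xk) \<bullet> (grad f z - grad f xk) \<le> Lf * norm (z - xk) * norm (y - xk)" if "z \<in> C" for z
    using norm_cauchy_schwarz[of "y - xk" "grad f z - grad f xk"]
      mult_left_mono[OF lipschitz_onD[OF _ that \<open>xk \<in> C\<close>, of Lf "grad f"], of "norm (y - xk)"]
    by (force simp: dist_norm mult_ac)
  then have "f y \<le> f xk + grad f xk \<bullet> (y - xk) + Lf / 2 * (norm (y - xk))\<^sup>2"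
    using f(1) C sol(1) by (intro descent_lemma[of f C]) (auto simp: continuously_differentiable_def)
  moreover have "P2 xk + \<zeta> \<bullet> (y - xk) \<le> P2 y"
    using \<zeta> by (simp add: subdiff_real)
  ultimately have "f y + P1 y - P2 y \<le> f xk + P1 xk - P2 xk
      + ((grad f xk - \<zeta>) \<bullet> (y - xk) + P1 y - P1 xk) + Lf / 2 * (norm (y - xk))\<^sup>2"
    by (simp add: inner_diff_left)
  then have "\<gamma> * (f y + P1 y - P2 y) \<le> \<gamma> * (f xk + P1 xk - P2 xk
      + ((grad f xk - \<zeta>) \<bullet> (y - xk) + P1 y - P1 xk) + Lf / 2 * (norm (y - xk))\<^sup>2)"
    using \<open>0 \<le> \<gamma>\<close> by (rule mult_left_mono)
  moreover have "0 \<le> \<gamma> * (- ((grad f xk - \<zeta>) \<bullet> (y - xk) + P1 y - P1 xk)) - grad G xk \<bullet> (y - xk)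
      - L / \<mu> * (norm (y - xk))\<^sup>2"
    using sol(2)[OF \<open>xk \<in> C\<close>]
    by (simp add: power2_norm_eq_inner inner_diff_left inner_diff_right inner_commute algebra_simps)
  ultimately show ?thesis
    using G[OF \<open>xk \<in> C\<close> sol(1)] by (simp add: algebra_simps add_divide_distrib)
qed

text \<open>A trial with parameter \<open>L'\<close> can be rejected only if \<open>2 * L' < c1 + \<gamma> * \<mu> * Lf + \<mu> * Lg\<close>. The
  accepted parameter is either the initial one or the double of a rejected one, which bounds it.\<close>

lemma sESQM_step_properties:
  assumes step: "sESQM_step f P1 P2 C G Llow Lup c1 \<gamma> \<mu> xk y"
    and C: "convex C" "xk \<in> C" and P1: "convex_on UNIV P1" and pos: "0 < \<gamma>" "0 < \<mu>" "0 < Llow"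
    and f: "continuously_differentiable f" "smooth_on_set Lf C f"
    and G: "\<And>x y. x \<in> C \<Longrightarrow> y \<in> C \<Longrightarrow> G y \<le> G x + grad G x \<bullet> (y - x) + Lg / 2 * (norm (y - x))\<^sup>2"
  obtains \<zeta> \<xi> n L where "y \<in> C"
    "\<zeta> \<in> subdiff (\<lambda>x. ereal (P2 x)) xk" "\<xi> \<in> subdiff (\<lambda>x. ereal (P1 x)) y" "n \<in> normal_cone C y"
    "0 < L" "L \<le> max Lup (c1 + \<gamma> * \<mu> * Lf + \<mu> * Lg)"
    "\<gamma> *\<^sub>R (grad f xk - \<zeta> + \<xi>) + grad G xk + (L / \<mu>) *\<^sub>R (y - xk) + n = 0"
    "\<gamma> * (f y + P1 y - P2 y) + G y
      \<le> \<gamma> * (f xk + P1 xk - P2 xk) + G xk - c1 / (2 * \<mu>) * (norm (y - xk))\<^sup>2"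
proof -
  obtain \<zeta> L0 i Y where \<zeta>: "\<zeta> \<in> subdiff (\<lambda>x. ereal (P2 x)) xk" and "L0 \<in> {Llow..Lup}"
    and trials: "\<forall>j\<le>i. is_arg_min (subproblem f P1 C G \<gamma> \<mu> xk \<zeta> (2 ^ j * L0)) (\<lambda>_. True) (Y j)"
      "\<forall>j<i. \<not> sufficient_decrease (objective f P1 P2 C) G c1 \<gamma> \<mu> xk (Y j)"
    and acc: "sufficient_decrease (objective f P1 P2 C) G c1 \<gamma> \<mu> xk (Y i)" and y: "y = Y i"
    using step unfolding sESQM_step_def by blast
  then have L0: "Llow \<le> L0" "L0 \<le> Lup" by auto
  have min: "is_arg_min (subproblem f P1 C G \<gamma> \<mu> xk \<zeta> (2 ^ j * L0)) (\<lambda>_. True) (Y j)" if "j \<le> i" for j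
    using trials(1) that by blast
  define L where "L = 2 ^ i * L0"
  have "L > 0" using L0 pos by (simp add: L_def)
  have "0 \<le> \<gamma>" using pos by simp
  note sol = subproblem_solution[OF min C P1 \<open>0 \<le> \<gamma>\<close>]
  have "y \<in> C" using sol(1)[of i] y by simp
  have "L \<le> max Lup (c1 + \<gamma> * \<mu> * Lf + \<mu> * Lg)"
  proof (cases i)
    case 0
    then show ?thesis using L0 by (simp add: L_def)
  next
    case (Suc j)
    let ?N = "(norm (Y j - xk))\<^sup>2" and ?L' = "2 ^ j * L0"
    have "\<not> sufficient_decrease (objective f P1 P2 C) G c1 \<gamma> \<mu> xk (Y j)" "Y j \<in> C"
      using trials(2) sol(1)[of j] Suc by simp_all
    then have "\<not> \<gamma> * (f (Y j) + P1 (Y j) - P2 (Y j)) + G (Y j)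
        \<le> \<gamma> * (f xk + P1 xk - P2 xk) + G xk - c1 / (2 * \<mu>) * ?N"
      using sufficient_decrease_iff[OF _ \<open>xk \<in> C\<close>] by blast
    moreover have "is_arg_min (subproblem f P1 C G \<gamma> \<mu> xk \<zeta> ?L') (\<lambda>_. True) (Y j)"
      using min[of j] Suc by simp
    note trial_point_decrease[OF this C P1 \<open>0 \<le> \<gamma>\<close> f G \<zeta>]
    ultimately have "- (c1 / (2 * \<mu>) * ?N) < ((\<gamma> * Lf + Lg) / 2 - ?L' / \<mu>) * ?N"
      by linarith
    then have "- (c1 / (2 * \<mu>)) * ?N < ((\<gamma> * Lf + Lg) / 2 - ?L' / \<mu>) * ?N"
      by simp
    then have "- (c1 / (2 * \<mu>)) < (\<gamma> * Lf + Lg) / 2 - ?L' / \<mu>"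
      by (rule mult_right_less_imp_less) simp
    then have "2 * ?L' < c1 + \<gamma> * \<mu> * Lf + \<mu> * Lg"
      using \<open>0 < \<mu>\<close> by (simp add: field_simps)
    then show ?thesis using Suc by (simp add: L_def)
  qed
  moreover
  let ?a = "(grad f xk - \<zeta>) + (1 / \<gamma>) *\<^sub>R (grad G xk + (L / \<mu>) *\<^sub>R (y - xk))"
  have "P1 y \<le> P1 z + ?a \<bullet> (z - y)" if "z \<in> C" for z
  proof -
    have "0 \<le> \<gamma> * ((grad f xk - \<zeta>) \<bullet> (z - y) + P1 z - P1 y) + grad G xk \<bullet> (z - y)
      + L / \<mu> * ((y - xk) \<bullet> (z - y))"
      using sol(2)[of i z] that y by (simp add: L_def)
    also have "\<dots> = \<gamma> * (P1 z + ?a \<bullet> (z - y) - P1 y)"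
    proof -
      have "\<gamma> * (pz + (a + 1 / \<gamma> * (g + k * D)) - py) = \<gamma> * (a + pz - py) + g + k * D"
        for a g k D pz py :: real
        using \<open>0 < \<gamma>\<close> by (simp add: field_simps)
      then show ?thesis by (simp only: inner_add_left inner_scaleR_left)
    qed
    finally show ?thesis using \<open>0 < \<gamma>\<close> by (simp add: zero_le_mult_iff)
  qed
  from convex_minimizer_subgradient_normal[OF P1 \<open>convex C\<close> \<open>y \<in> C\<close> this]
  obtain \<xi> n where \<xi>: "\<xi> \<in> subdiff (\<lambda>x. ereal (P1 x)) y" and n: "n \<in> normal_cone C y"
    and "?a + \<xi> + n = 0" by blast
  then have "\<gamma> *\<^sub>R (?a + \<xi> + n) = 0" by simp
  then have "\<gamma> *\<^sub>R (grad f xk - \<zeta> + \<xi>) + grad G xk + (L / \<mu>) *\<^sub>R (y - xk) + \<gamma> *\<^sub>R n = 0"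
    using \<open>0 < \<gamma>\<close> by (simp add: scaleR_add_right algebra_simps)
  moreover have "\<gamma> *\<^sub>R n \<in> normal_cone C y"
    using normal_cone_scaleR[OF \<open>y \<in> C\<close> n \<open>0 \<le> \<gamma>\<close>] .
  moreover have "\<gamma> * (f y + P1 y - P2 y) + G y
      \<le> \<gamma> * (f xk + P1 xk - P2 xk) + G xk - c1 / (2 * \<mu>) * (norm (y - xk))\<^sup>2"
    using acc sufficient_decrease_iff[OF \<open>y \<in> C\<close> \<open>xk \<in> C\<close>] y by simp
  ultimately show thesis
    using that \<open>y \<in> C\<close> \<zeta> \<xi> \<open>L > 0\<close> by blast
qed

section \<open>Bounds on gradients and subgradients over a compact set\<close>

text \<open>A subgradient at \<open>x\<close> forces an increase of \<open>P\<close> by its norm within the unit ball around \<open>x\<close>,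
  where \<open>P\<close> is bounded. This makes the supremum that defines the bound an actual one.\<close>

lemma subgradient_norm_le_bound:
  assumes "compact C" "convex_on UNIV P" "x \<in> C" "\<xi> \<in> subdiff (\<lambda>z. ereal (P z)) x"
  shows "norm \<xi> \<le> subgradient_bound P C"
proof -
  have "compact {x + y |x y. x \<in> C \<and> y \<in> cball 0 1}"
    using assms(1) by (intro compact_sums) auto
  then have "bounded (P ` {x + y |x y. x \<in> C \<and> y \<in> cball 0 1})" (is "bounded (P ` ?N)")
    using convex_on_continuous[OF open_UNIV assms(2)]
    by (intro compact_imp_bounded compact_continuous_image) (auto intro: continuous_on_subset)
  then obtain B where bound: "\<And>v. v \<in> P ` ?N \<Longrightarrow> norm v \<le> B"
    unfolding bounded_iff by blast
  have B: "\<bar>P (x + y)\<bar> \<le> B" if "x \<in> C" "norm y \<le> 1" for x y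
  proof -
    have "y \<in> cball 0 1" using that(2) by simp
    then have "x + y \<in> ?N" using that(1) by blast
    from bound[OF imageI[OF this]] show ?thesis by simp
  qed
  have "norm \<xi> \<le> 2 * B" if "\<xi> \<in> subdiff (\<lambda>z. ereal (P z)) x" "x \<in> C" for \<xi> x
  proof -
    have "P x + norm \<xi> \<le> P (x + sgn \<xi>)"
      using that(1)[unfolded subdiff_real, rule_format, of "x + sgn \<xi>"]
      by (cases "\<xi> = 0") (simp_all add: sgn_div_norm dot_square_norm power2_eq_square divide_inverse
          flip: mult.assoc)
    moreover have "\<bar>P (x + sgn \<xi>)\<bar> \<le> B" "\<bar>P (x + 0)\<bar> \<le> B"
      using B[OF that(2), of "sgn \<xi>"] B[OF that(2), of 0] by (auto simp: norm_sgn)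
    ultimately show ?thesis by simp
  qed
  then have "bdd_above {norm \<xi> |\<xi> x. \<xi> \<in> subdiff (\<lambda>x. ereal (P x)) x \<and> x \<in> C}"
    by (intro bdd_aboveI[of _ "2 * B"]) auto
  then show ?thesis
    unfolding subgradient_bound_def using assms by (intro cSup_upper) auto
qed

lemma lipschitz_norm_le_SUP:
  assumes "compact C" "L-lipschitz_on C F" "x \<in> C"
  shows "norm (F x) \<le> (SUP x\<in>C. norm (F x))"
proof (rule cSUP_upper[OF assms(3)])
  have "bounded (F ` C)"
    using assms by (intro compact_imp_bounded compact_continuous_image lipschitz_on_continuous_on)
  then obtain B where "\<forall>v\<in>F ` C. norm v \<le> B"
    unfolding bounded_iff by blast
  then show "bdd_above ((\<lambda>x. norm (F x)) ` C)"
    by (intro bdd_aboveI2[of _ _ B]) simp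
qed

section \<open>Two counting arguments\<close>

text \<open>Each increment of \<open>t\<close> removes one index from the window, and since the weights decrease,
  removing arbitrary indices costs at most as much as removing the same number of initial ones.\<close>

lemma weight_of_non_increments:
  fixes w :: "nat \<Rightarrow> real" and t :: "nat \<Rightarrow> nat"
  assumes dec: "decseq w"
    and t: "\<And>k. t (Suc k) = t k \<or> t (Suc k) = Suc (t k)" and "b \<le> n"
  shows "t b \<le> t n \<and> t n - t b \<le> n - b \<and>
    (\<Sum>k\<in>{b + (t n - t b)..<n}. w k) \<le> (\<Sum>k\<in>{k\<in>{b..<n}. t (Suc k) = t k}. w k)"
  using \<open>b \<le> n\<close>
proof (induction n rule: dec_induct)
  case (step n)
  define s where "s = b + (t n - t b)"
  have IH: "t b \<le> t n" "t n - t b \<le> n - b"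
    "(\<Sum>k\<in>{s..<n}. w k) \<le> (\<Sum>k\<in>{k\<in>{b..<n}. t (Suc k) = t k}. w k)"
    using step.IH by (auto simp: s_def)
  have "s \<le> n" using IH step.hyps by (simp add: s_def)
  show ?case
  proof (cases "t (Suc n) = t n")
    case True
    then have "{k \<in> {b..<Suc n}. t (Suc k) = t k} = insert n {k \<in> {b..<n}. t (Suc k) = t k}"
      using step.hyps by auto
    then have "(\<Sum>k\<in>{s..<Suc n}. w k) \<le> (\<Sum>k\<in>{k\<in>{b..<Suc n}. t (Suc k) = t k}. w k)"
      using IH \<open>s \<le> n\<close> by (simp add: sum.atLeastLessThan_Suc)
    moreover have "s = b + (t (Suc n) - t b)" using True by (simp add: s_def)
    ultimately show ?thesis using IH True by auto
  next
    case False
    then have inc: "t (Suc n) = Suc (t n)" using t by blast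
    have "(\<Sum>k\<in>{Suc s..<Suc n}. w k) \<le> (\<Sum>k\<in>{s..<n}. w k)"
      unfolding sum.shift_bounds_Suc_ivl by (intro sum_mono decseq_SucD[OF dec])
    also note IH(3)
    also have "{k \<in> {b..<n}. t (Suc k) = t k} = {k \<in> {b..<Suc n}. t (Suc k) = t k}"
      using False by (auto simp: less_Suc_eq)
    finally have "(\<Sum>k\<in>{Suc s..<Suc n}. w k) \<le> (\<Sum>k\<in>{k\<in>{b..<Suc n}. t (Suc k) = t k}. w k)" .
    moreover have "Suc s = b + (t (Suc n) - t b)" using inc IH by (simp add: s_def)
    ultimately show ?thesis using IH inc step.hyps by auto
  qed
qed simp

text \<open>Otherwise summing over \<open>R\<close> would make the total of \<open>a\<close> at least \<open>M\<close>.\<close>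

lemma exists_small_ratio:
  fixes a w :: "'i \<Rightarrow> real"
  assumes "finite R" "sum a R < M" "0 < s" "s \<le> sum w R" "0 \<le> M"
  shows "\<exists>k\<in>R. a k \<le> M / s * w k"
proof (rule ccontr)
  assume "\<not> ?thesis"
  then have "M / s * sum w R \<le> sum a R"
    unfolding sum_distrib_left by (intro sum_mono) (auto simp: not_le less_imp_le)
  moreover have "M / s * s \<le> M / s * sum w R"
    using assms by (intro mult_left_mono) auto
  ultimately show False
    using assms by simp
qed

section \<open>Sequences generated by the algorithm\<close>

locale sESQM_run = smoothed_composite \<phi>s \<phi>1 \<phi>2 \<phi>31 \<phi>32 C c h hs Lc Mc Mh h1 h2 h31 h32
  for \<phi>s :: "real \<Rightarrow> real \<Rightarrow> real" and \<phi>1 \<phi>2 \<phi>31 \<phi>32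
    and C :: "'a::euclidean_space set" and c :: "'a \<Rightarrow> 'b::euclidean_space" and h hs
    and Lc Mc Mh h1 h2 h31 h32 +
  fixes f P1 P2 :: "'a \<Rightarrow> real"
    and Lf h4 \<phi>4 Llow Lup c1 c2 :: real
    and \<gamma>hat \<mu> \<gamma> :: "nat \<Rightarrow> real" and x :: "nat \<Rightarrow> 'a" and t :: "nat \<Rightarrow> nat"
  assumes compact_C: "compact C"
    and f: "continuously_differentiable f" "smooth_on_set Lf C f"
    and P1: "convex_on UNIV P1" and P2: "convex_on UNIV P2"
    and monotone: "smoothing_monotone hs h4" "smoothing_monotone \<phi>s \<phi>4"
    and inputs: "0 < Llow" "0 < c1" "0 < c2"
    and generated: "sESQM_generated f P1 P2 C c hs \<phi>s (\<phi>31 + \<phi>32) Llow Lup c1 c2 \<gamma>hat x \<mu> t \<gamma>"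
    and \<mu>_pos: "\<And>k. 0 < \<mu> k" and \<mu>_dec: "decseq \<mu>" and \<mu>_lim: "\<mu> \<longlonglongrightarrow> 0"
    and \<gamma>hat_pos: "\<And>k. 0 < \<gamma>hat k" and \<gamma>hat_dec: "decseq \<gamma>hat" and \<gamma>hat_lim: "\<gamma>hat \<longlonglongrightarrow> 0"
begin

abbreviation F :: "'a \<Rightarrow> real"
  where "F y \<equiv> f y + P1 y - P2 y"

abbreviation mbar :: real
  where "mbar \<equiv> real_of_ereal (INF y. objective f P1 P2 C y)"

definition L_max :: real
  where "L_max = max Lup (c1 + \<gamma> 0 * \<mu> 0 * Lf + \<mu> 0 * L_G (\<mu> 0))"

abbreviation Mf :: real
  where "Mf \<equiv> (SUP y\<in>C. norm (grad f y))"

abbreviation \<alpha>31 :: real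
  where "\<alpha>31 \<equiv> max h31 0 + \<phi>31"

abbreviation Q :: "nat \<Rightarrow> real"
  where "Q k \<equiv> \<gamma> k * (F (x k) - mbar) + G (\<mu> k) (x k) + (h4 + \<phi>4) * \<mu> k"

abbreviation len :: "nat \<Rightarrow> real"
  where "len k \<equiv> norm (x (Suc k) - x k)"

abbreviation increases :: "nat \<Rightarrow> bool"
  where "increases k \<equiv>
    hs (\<mu> k) (c (x (Suc k))) > 2 * (\<phi>31 + \<phi>32) * \<mu> k \<and> len k \<le> c2 * \<mu> k * \<gamma> k"

abbreviation slope_new :: "nat \<Rightarrow> real"
  where "slope_new k \<equiv> slope (\<mu> k) (c (x (Suc k)))"

abbreviation u_new :: "nat \<Rightarrow> 'b"
  where "u_new k \<equiv> grad (hs (\<mu> k)) (c (x (Suc k)))"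

lemma \<gamma>_eq: "\<gamma> k = \<gamma>hat (t k)"
  and step: "sESQM_step f P1 P2 C (G (\<mu> k)) Llow Lup c1 (\<gamma> k) (\<mu> k) (x k) (x (Suc k))"
  and t_Suc: "t (Suc k) = (if increases k then t k + 1 else t k)"
  and x_0: "x 0 \<in> C" and t_0: "t 0 = 0"
  using generated unfolding sESQM_generated_def by blast+

lemma \<gamma>_pos: "0 < \<gamma> k"
  by (simp add: \<gamma>_eq \<gamma>hat_pos)

lemma \<gamma>_le_\<gamma>0: "\<gamma> k \<le> \<gamma> 0"
  using \<gamma>hat_dec by (simp add: \<gamma>_eq t_0 decseqD)

lemma \<gamma>_Suc_le: "\<gamma> (Suc k) \<le> \<gamma> k"
  unfolding \<gamma>_eq by (intro decseqD[OF \<gamma>hat_dec]) (simp add: t_Suc)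

lemma \<mu>_le: "i \<le> k \<Longrightarrow> \<mu> k \<le> \<mu> i"
  using \<mu>_dec by (rule decseqD)

lemma t_le: "t k \<le> k"
  by (induction k) (auto simp: t_0 t_Suc)

lemma Lf_nonneg: "0 \<le> Lf"
  using f(2) lipschitz_on_nonneg unfolding smooth_on_set_def by blast

lemma grad_f_lipschitz: "Lf-lipschitz_on C (grad f)"
  using f by (intro grad_lipschitz_on) (auto simp: continuously_differentiable_def smooth_on_set_def)

lemma \<mu>_L_G_le: "\<mu> k * L_G (\<mu> k) \<le> \<mu> 0 * L_G (\<mu> 0)"
  by (rule mult_L_G_mono[OF \<mu>_pos \<mu>_le]) simp

lemma iteration:
  assumes "x k \<in> C"
  obtains \<zeta> \<xi> n L where "x (Suc k) \<in> C"
    "\<zeta> \<in> subdiff (\<lambda>y. ereal (P2 y)) (x k)" "\<xi> \<in> subdiff (\<lambda>y. ereal (P1 y)) (x (Suc k))"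
    "n \<in> normal_cone C (x (Suc k))" "0 < L" "L \<le> L_max"
    "\<gamma> k *\<^sub>R (grad f (x k) - \<zeta> + \<xi>) + grad (G (\<mu> k)) (x k)
      + (L / \<mu> k) *\<^sub>R (x (Suc k) - x k) + n = 0"
    "\<gamma> k * F (x (Suc k)) + G (\<mu> k) (x (Suc k))
      \<le> \<gamma> k * F (x k) + G (\<mu> k) (x k) - c1 / (2 * \<mu> k) * (len k)\<^sup>2"
proof -
  have "\<gamma> k * \<mu> k * Lf \<le> \<gamma> 0 * \<mu> 0 * Lf"
    using \<gamma>_le_\<gamma>0[of k] \<mu>_le[of 0 k] \<gamma>_pos[of k] \<gamma>_pos[of 0] \<mu>_pos[of k] Lf_nonneg
    by (intro mult_right_mono mult_mono) auto
  then have "max Lup (c1 + \<gamma> k * \<mu> k * Lf + \<mu> k * L_G (\<mu> k)) \<le> L_max"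
    using \<mu>_L_G_le[of k] unfolding L_max_def by linarith
  note L_max = this
  show thesis
  proof (rule sESQM_step_properties[where Lg = "L_G (\<mu> k)",
        OF step convex_C assms P1 \<gamma>_pos \<mu>_pos inputs(1) f])
    show "G (\<mu> k) z \<le> G (\<mu> k) y + grad (G (\<mu> k)) y \<bullet> (z - y) + L_G (\<mu> k) / 2 * (norm (z - y))\<^sup>2"
      if "y \<in> C" "z \<in> C" for y z
      using \<mu>_pos that by (rule G_descent)
  qed (rule that, assumption+, erule order_trans[OF _ L_max], assumption+)
qed

lemma x_in_C: "x k \<in> C"
  by (induction k) (use x_0 iteration in blast)+

text \<open>The optimality condition of the subproblem at the old linearisation point is rewritten as one
  for the smoothed constraint at the new point. The gradient changes little along \<open>C\<close>; its change
  across \<open>C\<close> is moved into the normal vector.\<close>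

lemma approximate_stationarity:
  obtains \<zeta> \<xi> n where
    "\<zeta> \<in> subdiff (\<lambda>y. ereal (P2 y)) (x k)" "\<xi> \<in> subdiff (\<lambda>y. ereal (P1 y)) (x (Suc k))"
    "n \<in> normal_cone C (x (Suc k))"
    "norm (\<gamma> k *\<^sub>R (grad f (x k) - \<zeta> + \<xi>)
      + slope_new k *\<^sub>R adjoint (blinfun_apply (jac c (x (Suc k)))) (u_new k) + n)
      \<le> (L_max + \<mu> 0 * L_G (\<mu> 0)) * (len k / \<mu> k)"
proof -
  obtain \<zeta> \<xi> n L where it: "\<zeta> \<in> subdiff (\<lambda>y. ereal (P2 y)) (x k)"
    "\<xi> \<in> subdiff (\<lambda>y. ereal (P1 y)) (x (Suc k))" "n \<in> normal_cone C (x (Suc k))" "0 < L" "L \<le> L_max"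
    and opt: "\<gamma> k *\<^sub>R (grad f (x k) - \<zeta> + \<xi>) + grad (G (\<mu> k)) (x k)
      + (L / \<mu> k) *\<^sub>R (x (Suc k) - x k) + n = 0"
    using iteration[OF x_in_C[of k]] by metis
  let ?a = "grad (G (\<mu> k)) (x k) - grad (G (\<mu> k)) (x (Suc k))"
  have "d \<bullet> ?a \<le> (L_G (\<mu> k) * len k) * norm d" if "d \<in> direction_space C" for d
    using grad_G_lipschitz_along[OF \<mu>_pos x_in_C x_in_C that, of k k "Suc k"]
    by (simp add: norm_minus_commute)
  moreover have "0 \<le> L_G (\<mu> k) * len k"
    by (intro mult_nonneg_nonneg L_G_nonneg \<mu>_pos) simp
  ultimately obtain z where z: "norm (?a - z) \<le> L_G (\<mu> k) * len k" "z \<in> normal_cone C (x (Suc k))"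
    using normal_cone_absorbs_orthogonal[OF x_in_C] by metis
  have "linear (adjoint (blinfun_apply (jac c (x (Suc k)))))"
    by (intro adjoint_linear bounded_linear.linear blinfun.bounded_linear_right)
  then have "grad (G (\<mu> k)) (x (Suc k))
      = slope_new k *\<^sub>R adjoint (blinfun_apply (jac c (x (Suc k)))) (u_new k)"
    by (simp add: grad_G[OF \<mu>_pos] linear_scale)
  then have eq: "\<gamma> k *\<^sub>R (grad f (x k) - \<zeta> + \<xi>)
      + slope_new k *\<^sub>R adjoint (blinfun_apply (jac c (x (Suc k)))) (u_new k) + (n + z)
      = - (?a - z) - (L / \<mu> k) *\<^sub>R (x (Suc k) - x k)" (is "?r = _")
    using opt by (simp add: algebra_simps eq_neg_iff_add_eq_0)
  have "norm ?r \<le> norm (?a - z) + norm ((L / \<mu> k) *\<^sub>R (x (Suc k) - x k))"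
    unfolding eq by (metis norm_minus_cancel norm_triangle_ineq4)
  also have "\<dots> \<le> L_G (\<mu> k) * len k + L / \<mu> k * len k"
    using z(1) \<open>0 < L\<close> \<mu>_pos[of k] by simp
  also have "\<dots> = (L + \<mu> k * L_G (\<mu> k)) * (len k / \<mu> k)"
    using \<mu>_pos[of k] by (simp add: field_simps)
  also have "\<dots> \<le> (L_max + \<mu> 0 * L_G (\<mu> 0)) * (len k / \<mu> k)"
    using it(5) \<mu>_L_G_le[of k] less_imp_le[OF \<mu>_pos[of k]] by (intro mult_right_mono add_mono) auto
  finally show thesis
    using that[OF it(1,2) normal_cone_add[OF x_in_C it(3) z(2)]] by blast
qed

subsection \<open>Decrease of the merit function\<close>

text \<open>The infimum over the whole space is attained on \<open>C\<close>, so converting it from the extended reals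
  loses nothing.\<close>

lemma mbar_le:
  assumes "y \<in> C"
  shows "mbar \<le> F y"
proof -
  have "continuous_on UNIV f"
    using f(1) by (auto simp: continuously_differentiable_def
        intro!: continuous_at_imp_continuous_on differentiable_imp_continuous_within)
  then have "continuous_on C F"
    using convex_on_continuous[OF open_UNIV P1] convex_on_continuous[OF open_UNIV P2]
    by (intro continuous_intros) (auto intro: continuous_on_subset)
  then obtain y0 where y0: "y0 \<in> C" "\<And>y. y \<in> C \<Longrightarrow> F y0 \<le> F y"
    using continuous_attains_inf[OF compact_C, of F] assms by blast
  have "(INF y. objective f P1 P2 C y) = ereal (F y0)"
  proof (rule antisym)
    show "(INF y. objective f P1 P2 C y) \<le> ereal (F y0)"
      using INF_lower[of y0 UNIV "objective f P1 P2 C"] y0(1) by (simp add: objective_def delta_def)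
    show "ereal (F y0) \<le> (INF y. objective f P1 P2 C y)"
      using y0(2) by (intro INF_greatest) (auto simp: objective_def delta_def)
  qed
  then show ?thesis using y0(2)[OF assms] by simp
qed

text \<open>The three ingredients are the acceptance test, the decrease of \<open>\<gamma>\<close> against the nonnegative
  objective gap, and the drift of the smoothed constraint in \<open>\<mu>\<close>, which the last term of the merit
  function absorbs.\<close>

lemma Q_decrease: "Q (Suc k) + c1 / (2 * \<mu> k) * (len k)\<^sup>2 \<le> Q k"
proof -
  have "\<gamma> k * F (x (Suc k)) + G (\<mu> k) (x (Suc k))
      \<le> \<gamma> k * F (x k) + G (\<mu> k) (x k) - c1 / (2 * \<mu> k) * (len k)\<^sup>2"
    using iteration[OF x_in_C[of k]] by metis
  moreover have "\<gamma> (Suc k) * (F (x (Suc k)) - mbar) \<le> \<gamma> k * (F (x (Suc k)) - mbar)"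
    using mbar_le[OF x_in_C, of "Suc k"] by (intro mult_right_mono \<gamma>_Suc_le) simp
  moreover have "G (\<mu> (Suc k)) (x (Suc k))
      \<le> G (\<mu> k) (x (Suc k)) + (h4 + \<phi>4) * (\<mu> k - \<mu> (Suc k))"
    by (rule G_monotone[OF monotone \<mu>_pos \<mu>_le]) simp
  ultimately show ?thesis
    by (simp only: right_diff_distrib)
qed

lemma Q_ge: "- (max \<alpha>31 0 * \<mu> 0) \<le> Q k"
proof -
  have "\<phi>31 * \<mu> k \<le> max \<alpha>31 0 * \<mu> 0"
  proof -
    have "\<phi>31 * \<mu> k \<le> max \<alpha>31 0 * \<mu> k"
      using \<mu>_pos[of k] by (intro mult_right_mono) auto
    also have "\<dots> \<le> max \<alpha>31 0 * \<mu> 0"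
      using \<mu>_le[of 0 k] by (intro mult_left_mono) auto
    finally show ?thesis .
  qed
  moreover have "0 \<le> \<gamma> k * (F (x k) - mbar)" "0 \<le> (h4 + \<phi>4) * \<mu> k"
    using \<gamma>_pos[of k] mbar_le[OF x_in_C, of k] \<mu>_pos[of k] monotone
    by (auto simp: smoothing_monotone_def)
  ultimately show ?thesis
    using G_ge[OF \<mu>_pos, of k "x k"] by linarith
qed

lemma Q_0_plus_nonneg: "0 \<le> Q 0 + max \<alpha>31 0 * \<mu> 0"
  using Q_ge[of 0] by linarith

lemma sum_steps_le:
  "(\<Sum>k<n. (len k)\<^sup>2 / \<mu> k) \<le> 2 * (Q 0 + max \<alpha>31 0 * \<mu> 0) / c1"
proof -
  have "(\<Sum>k<n. c1 / (2 * \<mu> k) * (len k)\<^sup>2) \<le> Q 0 - Q n"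
  proof (induction n)
    case (Suc n)
    then show ?case using Q_decrease[of n] by simp
  qed simp
  also have "\<dots> \<le> Q 0 + max \<alpha>31 0 * \<mu> 0"
    using Q_ge[of n] by linarith
  also have "(\<Sum>k<n. c1 / (2 * \<mu> k) * (len k)\<^sup>2) = c1 / 2 * (\<Sum>k<n. (len k)\<^sup>2 / \<mu> k)"
    unfolding sum_distrib_left by (intro sum.cong) auto
  finally show ?thesis
    using inputs(2) by (simp add: field_simps)
qed

subsection \<open>The penalty parameter stays away from zero\<close>

lemma bounds_nonneg: "0 \<le> Mf" "0 \<le> subgradient_bound P1 C" "0 \<le> subgradient_bound P2 C"
proof -
  (* The suprema are over nonempty sets because the first iteration uses subgradients of both. *)
  obtain \<zeta> \<xi> where "\<zeta> \<in> subdiff (\<lambda>y. ereal (P2 y)) (x 0)" "\<xi> \<in> subdiff (\<lambda>y. ereal (P1 y)) (x (Suc 0))"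
    using approximate_stationarity[of 0] by metis
  then show "0 \<le> subgradient_bound P1 C" "0 \<le> subgradient_bound P2 C"
    using subgradient_norm_le_bound[OF compact_C] P1 P2 x_in_C norm_ge_zero order_trans by meson+
  show "0 \<le> Mf"
    using lipschitz_norm_le_SUP[OF compact_C grad_f_lipschitz x_0] norm_ge_zero order_trans by blast
qed

lemma L_max_pos: "0 < L_max"
proof -
  have "0 \<le> \<gamma> 0 * \<mu> 0 * Lf" "0 \<le> \<mu> 0 * L_G (\<mu> 0)"
    using \<gamma>_pos[of 0] \<mu>_pos[of 0] Lf_nonneg L_G_nonneg[OF \<mu>_pos[of 0]] by simp_all
  then show ?thesis using inputs(2) unfolding L_max_def by linarith
qed

text \<open>Up to the factor \<open>\<gamma> k\<close>, this bounds everything in the stationarity condition except the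
  constraint and normal cone terms when the step is at most \<open>c2 * \<mu> k * \<gamma> k\<close>.\<close>

definition gamma_terms_bound :: real
  where "gamma_terms_bound = Mf + subgradient_bound P1 C + subgradient_bound P2 C + c2 * (L_max + \<mu> 0 * L_G (\<mu> 0))"

lemma D_pos: "0 < gamma_terms_bound"
proof -
  have "0 < L_max + \<mu> 0 * L_G (\<mu> 0)"
    using L_max_pos \<mu>_pos[of 0] L_G_nonneg[OF \<mu>_pos[of 0]] by (intro add_pos_nonneg) simp_all
  then have "0 < c2 * (L_max + \<mu> 0 * L_G (\<mu> 0))"
    using inputs(3) by (rule mult_pos_pos[rotated])
  then show ?thesis using bounds_nonneg unfolding gamma_terms_bound_def by linarith
qed

text \<open>The penalty parameter is lowered only at points that are still infeasible although the step
  is short. There the smoothed positive part has slope at least \<open>1/2\<close>, so the constraint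
  qualification bounds the constraint part of the stationarity condition from below by \<open>\<eta>/2\<close>,
  while the remaining terms are all proportional to \<open>\<gamma> k\<close>.\<close>

lemma increase_imp_\<gamma>_ge:
  assumes CQ: "CQ_constant C c h \<eta>"
    and small: "(h31 + h32) * \<mu> k \<le> \<eta>" "h32 * \<mu> k \<le> \<eta>"
    and inc: "increases k"
  shows "\<eta> / 2 \<le> \<gamma> k * gamma_terms_bound"
proof -
  let ?B = "L_max + \<mu> 0 * L_G (\<mu> 0)" and ?J = "adjoint (blinfun_apply (jac c (x (Suc k))))"
  obtain \<zeta> \<xi> n where \<zeta>: "\<zeta> \<in> subdiff (\<lambda>y. ereal (P2 y)) (x k)"
    and \<xi>: "\<xi> \<in> subdiff (\<lambda>y. ereal (P1 y)) (x (Suc k))" and n: "n \<in> normal_cone C (x (Suc k))"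
    and stat: "norm (\<gamma> k *\<^sub>R (grad f (x k) - \<zeta> + \<xi>) + slope_new k *\<^sub>R ?J (u_new k) + n)
      \<le> ?B * (len k / \<mu> k)"
    using approximate_stationarity by metis
  have slope: "1 / 2 \<le> slope_new k"
    using inc by (intro deriv_ge_half \<mu>_pos) simp
  have "0 \<le> 2 * (\<phi>31 + \<phi>32) * \<mu> k"
    using smoothing_approxD(3)[OF \<phi>s] \<mu>_pos[of k] by simp
  then have "- \<eta> \<le> h (c (x (Suc k)))"
    using smoothing_approxD(8)[OF hs \<mu>_pos[of k], of "c (x (Suc k))"] inc small(2) by linarith
  moreover have "u_new k \<in> eps_subdiff \<eta> (\<lambda>y. ereal (h y)) (c (x (Suc k)))"
    by (rule eps_subdiff_mono[OF smoothing_gradient_eps_subgradient[OF hs \<mu>_pos] small(1)])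
  moreover have "(1 / slope_new k) *\<^sub>R n \<in> normal_cone C (x (Suc k))"
    using slope by (intro normal_cone_scaleR x_in_C n) simp
  ultimately have "\<eta> \<le> norm (?J (u_new k) + (1 / slope_new k) *\<^sub>R n)"
    by (intro CQ_constantD[OF CQ x_in_C])
  then have "1 / 2 * \<eta> \<le> slope_new k * norm (?J (u_new k) + (1 / slope_new k) *\<^sub>R n)"
    using slope CQ by (intro mult_mono) (auto simp: CQ_constant_def)
  also have "\<dots> = norm (slope_new k *\<^sub>R (?J (u_new k) + (1 / slope_new k) *\<^sub>R n))"
    using slope by simp
  also have "\<dots> = norm (slope_new k *\<^sub>R ?J (u_new k) + n)"
    using slope by (simp add: scaleR_add_right)
  also have "\<dots> \<le> ?B * (len k / \<mu> k) + norm (\<gamma> k *\<^sub>R (grad f (x k) - \<zeta> + \<xi>))"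
  proof -
    have "norm (slope_new k *\<^sub>R ?J (u_new k) + n)
        = norm ((\<gamma> k *\<^sub>R (grad f (x k) - \<zeta> + \<xi>) + slope_new k *\<^sub>R ?J (u_new k) + n)
            - \<gamma> k *\<^sub>R (grad f (x k) - \<zeta> + \<xi>))"
      by (simp add: add.assoc)
    also have "\<dots> \<le> norm (\<gamma> k *\<^sub>R (grad f (x k) - \<zeta> + \<xi>) + slope_new k *\<^sub>R ?J (u_new k) + n)
        + norm (\<gamma> k *\<^sub>R (grad f (x k) - \<zeta> + \<xi>))"
      by (rule norm_triangle_ineq4)
    finally show ?thesis using stat by linarith
  qed
  also have "\<dots> \<le> ?B * (c2 * \<gamma> k) + \<gamma> k * (Mf + subgradient_bound P1 C + subgradient_bound P2 C)"
  proof (rule add_mono)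
    have "len k / \<mu> k \<le> c2 * \<gamma> k"
      using inc \<mu>_pos[of k] by (simp add: pos_divide_le_eq mult_ac)
    then show "?B * (len k / \<mu> k) \<le> ?B * (c2 * \<gamma> k)"
      using L_max_pos \<mu>_pos[of 0] L_G_nonneg[OF \<mu>_pos[of 0]]
      by (intro mult_left_mono add_nonneg_nonneg) simp_all
    have "norm (grad f (x k) - \<zeta> + \<xi>) \<le> norm (grad f (x k)) + norm \<zeta> + norm \<xi>"
      using norm_triangle_ineq[of "grad f (x k) - \<zeta>" \<xi>] norm_triangle_ineq4[of "grad f (x k)" \<zeta>]
      by linarith
    also have "\<dots> \<le> Mf + subgradient_bound P1 C + subgradient_bound P2 C"
      using lipschitz_norm_le_SUP[OF compact_C grad_f_lipschitz x_in_C[of k]]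
        subgradient_norm_le_bound[OF compact_C P1 x_in_C \<xi>]
        subgradient_norm_le_bound[OF compact_C P2 x_in_C \<zeta>] by linarith
    finally show "norm (\<gamma> k *\<^sub>R (grad f (x k) - \<zeta> + \<xi>))
        \<le> \<gamma> k * (Mf + subgradient_bound P1 C + subgradient_bound P2 C)"
      using \<gamma>_pos[of k] by (simp add: mult_left_mono)
  qed
  also have "\<dots> = \<gamma> k * gamma_terms_bound"
    by (simp add: gamma_terms_bound_def algebra_simps)
  finally show ?thesis by simp
qed

text \<open>The claim is that the counter stays in the initial segment of indices with \<open>\<gamma>hat\<close> at least
  \<open>\<eta>\<gamma>\<close>. Before \<open>k0\<close> this holds since the counter grows by at most one per iteration; this is what the
  second entry of the minimum provides. After \<open>k0\<close> the smoothing errors are below \<open>\<eta>\<close>, and an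
  increment certifies that \<open>\<gamma> k\<close> is at least \<open>M\<gamma>hat\<close> times the first entry, so the next value of
  \<open>\<gamma>hat\<close> is still large enough.\<close>

lemma t_bounded:
  fixes \<eta> M\<gamma>hat
  assumes CQ: "CQ_constant C c h \<eta>"
    and M\<gamma>hat: "1 < M\<gamma>hat" "\<And>k. \<gamma>hat k \<le> M\<gamma>hat * \<gamma>hat (Suc k)"
  defines "k0 \<equiv> LEAST k. \<mu> k \<le> \<eta> / max (h31 + h32) (max h32 0)"
  defines "\<eta>\<gamma> \<equiv> min (\<eta> / (2 * M\<gamma>hat * gamma_terms_bound)) (\<gamma>hat (k0 + 1))"
  shows "0 < \<eta>\<gamma>" and "t k \<le> Max {t. \<gamma>hat t \<ge> \<eta>\<gamma>}" and "\<eta>\<gamma> \<le> \<gamma> k"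
proof -
  let ?m = "max (h31 + h32) (max h32 0)" and ?T = "{t. \<gamma>hat t \<ge> \<eta>\<gamma>}"
  have "0 < \<eta>" using CQ by (simp add: CQ_constant_def)
  have m: "0 < ?m" using smoothing_approxD(3)[OF hs] by simp
  show "0 < \<eta>\<gamma>"
    using \<open>0 < \<eta>\<close> D_pos M\<gamma>hat(1) \<gamma>hat_pos by (simp add: \<eta>\<gamma>_def)
  have "\<exists>k. \<mu> k \<le> \<eta> / ?m"
  proof -
    have "\<forall>\<^sub>F k in sequentially. \<mu> k < \<eta> / ?m"
      using order_tendstoD(2)[OF \<mu>_lim] \<open>0 < \<eta>\<close> m by simp
    then show ?thesis
      by (metis eventually_sequentially less_imp_le order_refl)
  qed
  then have k0: "\<mu> k0 \<le> \<eta> / ?m"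
    unfolding k0_def by (rule LeastI_ex)
  obtain N where N: "\<And>n. N \<le> n \<Longrightarrow> \<gamma>hat n < \<eta>\<gamma>"
    using order_tendstoD(2)[OF \<gamma>hat_lim \<open>0 < \<eta>\<gamma>\<close>] unfolding eventually_sequentially by blast
  have "?T \<subseteq> {..<N}"
    using N by (force simp: not_le[symmetric])
  then have "finite ?T" by (rule finite_subset) simp
  have "t k \<in> ?T" for k
  proof (induction k)
    case 0
    have "\<eta>\<gamma> \<le> \<gamma>hat (k0 + 1)" by (simp add: \<eta>\<gamma>_def)
    also have "\<dots> \<le> \<gamma>hat (t 0)" by (intro decseqD[OF \<gamma>hat_dec]) (simp add: t_0)
    finally show ?case by simp
  next
    case (Suc k)
    show ?case
    proof (cases "k < k0 \<or> \<not> increases k")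
      case True
      show ?thesis
      proof (cases "increases k")
        case False
        then have "t (Suc k) = t k" by (simp add: t_Suc)
        then show ?thesis using Suc by simp
      next
        case inc: True
        have "\<eta>\<gamma> \<le> \<gamma>hat (k0 + 1)" by (simp add: \<eta>\<gamma>_def)
        also have "\<dots> \<le> \<gamma>hat (t (Suc k))"
          using t_le[of "Suc k"] inc True by (intro decseqD[OF \<gamma>hat_dec]) linarith
        finally show ?thesis by simp
      qed
    next
      case False
      then have "k0 \<le> k" and inc: "increases k" by auto
      have "?m * \<mu> k \<le> ?m * \<mu> k0"
        using \<mu>_le[OF \<open>k0 \<le> k\<close>] m by (intro mult_left_mono) auto
      also have "\<dots> \<le> \<eta>" using k0 m by (simp add: pos_le_divide_eq mult.commute)
      finally have bound: "?m * \<mu> k \<le> \<eta>" .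
      have "(h31 + h32) * \<mu> k \<le> ?m * \<mu> k" "h32 * \<mu> k \<le> ?m * \<mu> k"
        using \<mu>_pos[of k] by (intro mult_right_mono; simp)+
      then have "\<eta> / 2 \<le> \<gamma> k * gamma_terms_bound"
        using bound by (intro increase_imp_\<gamma>_ge[OF CQ _ _ inc]) linarith+
      moreover have "\<gamma> k * gamma_terms_bound \<le> (M\<gamma>hat * \<gamma>hat (Suc (t k))) * gamma_terms_bound"
        using M\<gamma>hat(2)[of "t k"] D_pos by (intro mult_right_mono) (auto simp: \<gamma>_eq)
      ultimately have "\<eta> \<le> 2 * ((M\<gamma>hat * \<gamma>hat (Suc (t k))) * gamma_terms_bound)" by linarith
      also have "\<dots> = \<gamma>hat (Suc (t k)) * (2 * M\<gamma>hat * gamma_terms_bound)" by simp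
      finally have "\<eta> \<le> \<gamma>hat (Suc (t k)) * (2 * M\<gamma>hat * gamma_terms_bound)" .
      then have "\<eta> / (2 * M\<gamma>hat * gamma_terms_bound) \<le> \<gamma>hat (Suc (t k))"
        using M\<gamma>hat(1) D_pos by (subst pos_divide_le_eq) auto
      moreover have "t (Suc k) = Suc (t k)" using t_Suc[of k] inc by simp
      ultimately show ?thesis by (simp add: \<eta>\<gamma>_def)
    qed
  qed
  then show "t k \<le> Max ?T" "\<eta>\<gamma> \<le> \<gamma> k"
    using \<open>finite ?T\<close> by (auto simp: \<gamma>_eq)
qed

subsection \<open>An index with a short step and no parameter update\<close>

text \<open>Steps without an increment carry at least the weight of \<open>{a..K}\<close>, because the window starts
  \<open>Mt\<close> indices earlier and contains at most \<open>Mt\<close> increments. So one of them is short relative to its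
  \<open>\<mu> k\<close>. For \<open>K\<close> large enough it meets the length test of the update rule, and the absence of an
  increment then certifies approximate feasibility.\<close>

lemma exists_short_step:
  assumes t: "\<And>k. t k \<le> Mt" and \<gamma>: "\<And>k. \<eta>\<gamma> \<le> \<gamma> k" and "0 < \<eta>\<gamma>"
    and "Mt \<le> a" "a \<le> K"
    and M2: "2 * (Q 0 + max \<alpha>31 0 * \<mu> 0) / c1 < M2"
    and S: "inverse (\<Sum>k = a..K. \<mu> k) \<le> (\<eta>\<gamma> * c2)\<^sup>2 / M2"
  obtains k where "k \<in> {a - Mt..K}" "len k \<le> sqrt M2 * \<mu> k / sqrt (\<Sum>k = a..K. \<mu> k)"
    "hs (\<mu> k) (c (x (Suc k))) \<le> 2 * (\<phi>31 + \<phi>32) * \<mu> k"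
proof -
  define s where "s = (\<Sum>k = a..K. \<mu> k)"
  define b where "b = a - Mt"
  define R where "R = {k \<in> {b..<Suc K}. t (Suc k) = t k}"
  have "finite R" "R \<subseteq> {..<Suc K}" by (auto simp: R_def)
  have "0 < s" using \<open>a \<le> K\<close> \<mu>_pos unfolding s_def by (intro sum_pos) auto
  have "0 \<le> 2 * (Q 0 + max \<alpha>31 0 * \<mu> 0) / c1"
    using Q_0_plus_nonneg inputs(2) by simp
  then have "0 < M2" using M2 by linarith
  have "s \<le> (\<Sum>k\<in>{b + (t (Suc K) - t b)..<Suc K}. \<mu> k)"
    using t[of "Suc K"] \<open>Mt \<le> a\<close> less_imp_le[OF \<mu>_pos] unfolding s_def b_def
    by (intro sum_mono2) auto
  also have "\<dots> \<le> sum \<mu> R"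
  proof -
    have "t (Suc k) = t k \<or> t (Suc k) = Suc (t k)" for k by (simp add: t_Suc)
    moreover have "b \<le> Suc K" using \<open>a \<le> K\<close> by (simp add: b_def)
    ultimately show ?thesis using weight_of_non_increments[OF \<mu>_dec] unfolding R_def by blast
  qed
  finally have "s \<le> sum \<mu> R" .
  moreover have "(\<Sum>k\<in>R. (len k)\<^sup>2 / \<mu> k) < M2"
  proof -
    have "(\<Sum>k\<in>R. (len k)\<^sup>2 / \<mu> k) \<le> (\<Sum>k<Suc K. (len k)\<^sup>2 / \<mu> k)"
      using less_imp_le[OF \<mu>_pos] \<open>R \<subseteq> _\<close> by (intro sum_mono2) auto
    then show ?thesis using sum_steps_le[of "Suc K"] M2 by linarith
  qed
  ultimately obtain k where k: "k \<in> R" "(len k)\<^sup>2 / \<mu> k \<le> M2 / s * \<mu> k"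
    using exists_small_ratio[of R "\<lambda>k. (len k)\<^sup>2 / \<mu> k" M2 s \<mu>] \<open>finite R\<close> \<open>0 < s\<close> \<open>0 < M2\<close> by auto
  have "(len k)\<^sup>2 \<le> M2 / s * \<mu> k * \<mu> k"
    using k(2) \<mu>_pos[of k] by (simp add: pos_divide_le_eq)
  also have "\<dots> = (sqrt M2 * \<mu> k / sqrt s)\<^sup>2"
    using \<open>0 < M2\<close> \<open>0 < s\<close> by (simp add: power_mult_distrib power_divide power2_eq_square[of "\<mu> k"])
  finally have len: "len k \<le> sqrt M2 * \<mu> k / sqrt s"
    by (rule power2_le_imp_le) (use \<open>0 < M2\<close> \<open>0 < s\<close> less_imp_le[OF \<mu>_pos[of k]] in simp)
  have "sqrt (M2 / s) \<le> \<eta>\<gamma> * c2"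
  proof (rule real_le_lsqrt)
    show "M2 / s \<le> (\<eta>\<gamma> * c2)\<^sup>2"
    proof -
      have "inverse s * M2 \<le> (\<eta>\<gamma> * c2)\<^sup>2"
        using S[folded s_def] \<open>0 < M2\<close> by (simp only: pos_le_divide_eq)
      then show ?thesis by (simp add: divide_inverse mult.commute)
    qed
  qed (use \<open>0 < \<eta>\<gamma>\<close> inputs(3) in auto)
  also have "\<dots> \<le> \<gamma> k * c2" using \<gamma>[of k] inputs(3) by simp
  finally have "sqrt (M2 / s) * \<mu> k \<le> \<gamma> k * c2 * \<mu> k"
    using \<mu>_pos[of k] by (intro mult_right_mono) auto
  then have "len k \<le> c2 * \<mu> k * \<gamma> k"
    using len by (simp add: real_sqrt_divide mult_ac)
  moreover have "\<not> increases k" using k(1) t_Suc[of k] by (auto simp: R_def)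
  ultimately have "hs (\<mu> k) (c (x (Suc k))) \<le> 2 * (\<phi>31 + \<phi>32) * \<mu> k" by simp
  moreover have "k \<in> {a - Mt..K}" using k(1) by (auto simp: R_def b_def)
  ultimately show thesis using that[of k] len unfolding s_def by blast
qed

subsection \<open>Optimality measures at the selected index\<close>

text \<open>Dividing the approximate stationarity condition by \<open>\<gamma> k\<close> gives an element of the set that defines
  the residual, except that the gradient of \<open>f\<close> is taken at the old point.\<close>

lemma residual_le:
  "stationarity_residual f P1 P2 C c (x k) (x (Suc k)) (inverse (\<gamma> k) * slope_new k) (u_new k)
    \<le> inverse (\<gamma> k) * (L_max + \<mu> 0 * \<gamma>hat 0 * Lf + \<mu> 0 * L_G (\<mu> 0)) * (len k / \<mu> k)"
proof -
  let ?B = "L_max + \<mu> 0 * L_G (\<mu> 0)" and ?J = "adjoint (blinfun_apply (jac c (x (Suc k))))"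
  obtain \<zeta> \<xi> n where \<zeta>: "\<zeta> \<in> subdiff (\<lambda>y. ereal (P2 y)) (x k)"
    and \<xi>: "\<xi> \<in> subdiff (\<lambda>y. ereal (P1 y)) (x (Suc k))" and n: "n \<in> normal_cone C (x (Suc k))"
    and stat: "norm (\<gamma> k *\<^sub>R (grad f (x k) - \<zeta> + \<xi>) + slope_new k *\<^sub>R ?J (u_new k) + n)
      \<le> ?B * (len k / \<mu> k)"
    using approximate_stationarity by metis
  let ?r = "grad f (x (Suc k)) - \<zeta> + \<xi> + (inverse (\<gamma> k) * slope_new k) *\<^sub>R ?J (u_new k) + inverse (\<gamma> k) *\<^sub>R n"
  have "inverse (\<gamma> k) *\<^sub>R n \<in> normal_cone C (x (Suc k))"
    using \<gamma>_pos[of k] by (intro normal_cone_scaleR x_in_C n) simp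
  then have "stationarity_residual f P1 P2 C c (x k) (x (Suc k)) (inverse (\<gamma> k) * slope_new k) (u_new k)
      \<le> dist 0 ?r"
    unfolding stationarity_residual_def using \<zeta> \<xi> by (intro infdist_le) blast
  also have "\<dots> = norm ?r" by simp
  also have "\<dots> \<le> inverse (\<gamma> k) * (?B * (len k / \<mu> k)) + Lf * len k"
  proof -
    let ?s = "\<gamma> k *\<^sub>R (grad f (x k) - \<zeta> + \<xi>) + slope_new k *\<^sub>R ?J (u_new k) + n"
    have "?r = inverse (\<gamma> k) *\<^sub>R ?s + (grad f (x (Suc k)) - grad f (x k))"
      using \<gamma>_pos[of k] by (simp add: scaleR_add_right scaleR_diff_right)
    then have "norm ?r \<le> norm (inverse (\<gamma> k) *\<^sub>R ?s) + norm (grad f (x (Suc k)) - grad f (x k))"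
      using norm_triangle_ineq by metis
    moreover have "norm (inverse (\<gamma> k) *\<^sub>R ?s) \<le> inverse (\<gamma> k) * (?B * (len k / \<mu> k))"
      unfolding norm_scaleR using stat \<gamma>_pos[of k] by (intro mult_mono) auto
    moreover have "norm (grad f (x (Suc k)) - grad f (x k)) \<le> Lf * len k"
      using lipschitz_onD[OF grad_f_lipschitz x_in_C x_in_C] by (simp add: dist_norm)
    ultimately show ?thesis by linarith
  qed
  also have "\<dots> \<le> inverse (\<gamma> k) * (?B * (len k / \<mu> k)) + inverse (\<gamma> k) * (\<mu> 0 * \<gamma>hat 0 * Lf) * (len k / \<mu> k)"
  proof -
    have "Lf * len k = inverse (\<gamma> k) * (\<mu> k * \<gamma> k * Lf) * (len k / \<mu> k)"
      using \<gamma>_pos[of k] \<mu>_pos[of k] by (simp add: field_simps)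
    also have "\<dots> \<le> inverse (\<gamma> k) * (\<mu> 0 * \<gamma>hat 0 * Lf) * (len k / \<mu> k)"
      using \<gamma>_pos[of k] \<gamma>hat_pos[of 0] \<mu>_pos[of k] \<mu>_pos[of 0] \<mu>_le[of 0 k] \<gamma>_le_\<gamma>0[of k] Lf_nonneg
      by (intro mult_right_mono mult_left_mono mult_mono) (auto simp: \<gamma>_eq[of 0] t_0)
    finally show ?thesis by simp
  qed
  finally show ?thesis by (simp add: algebra_simps)
qed

lemma multiplier_bounds: "0 \<le> slope_new k" "slope_new k \<le> 1"
  using deriv_nonneg[OF \<mu>_pos] deriv_le_1[OF \<mu>_pos] by auto

lemma constraint_le:
  assumes "hs (\<mu> k) (c (x (Suc k))) \<le> 2 * (\<phi>31 + \<phi>32) * \<mu> k"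
  shows "max (h (c (x (Suc k)))) 0 \<le> (3 * (\<phi>31 + \<phi>32) + max h31 0) * \<mu> k"
proof -
  have "h31 * \<mu> k \<le> max h31 0 * \<mu> k" "0 \<le> (\<phi>31 + \<phi>32) * \<mu> k" "0 \<le> max h31 0 * \<mu> k"
    using \<mu>_pos[of k] smoothing_approxD(3)[OF \<phi>s] by (auto intro: mult_right_mono)
  then show ?thesis
    using assms smoothing_approxD(7)[OF hs \<mu>_pos[of k], of "c (x (Suc k))"]
    by (simp add: distrib_right)
qed

text \<open>For a nonnegative constraint value the feasibility bound suffices, as the slope is at most \<open>1\<close>.
  For a negative one, convexity bounds the product of the slope and the modulus of the smoothed value
  by the smoothing error, however negative the value is.\<close>

lemma complementarity_le:
  assumes "hs (\<mu> k) (c (x (Suc k))) \<le> 2 * (\<phi>31 + \<phi>32) * \<mu> k"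
  shows "\<bar>slope_new k * h (c (x (Suc k)))\<bar> \<le> (3 * (\<phi>31 + \<phi>32) + max h31 0 + max h32 0) * \<mu> k"
proof -
  let ?g = "h (c (x (Suc k)))" and ?s = "hs (\<mu> k) (c (x (Suc k)))"
  have nn: "0 \<le> max h31 0 * \<mu> k" "0 \<le> max h32 0 * \<mu> k" "0 \<le> (\<phi>31 + \<phi>32) * \<mu> k"
    "h32 * \<mu> k \<le> max h32 0 * \<mu> k"
    using \<mu>_pos[of k] smoothing_approxD(3)[OF \<phi>s] by (auto intro: mult_right_mono)
  show ?thesis
  proof (cases "0 \<le> ?g")
    case True
    then have "\<bar>slope_new k * ?g\<bar> \<le> max ?g 0"
      using multiplier_bounds[of k] by (simp add: abs_mult mult_left_le_one_le)
    then show ?thesis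
      using constraint_le[OF assms] nn by (simp add: distrib_right)
  next
    case False
    then have "\<bar>slope_new k * ?g\<bar> = slope_new k * - ?g"
      using multiplier_bounds[of k] by (simp add: abs_mult)
    also have "\<dots> \<le> slope_new k * (- min ?s 0 + max h32 0 * \<mu> k)"
      using smoothing_approxD(8)[OF hs \<mu>_pos[of k], of "c (x (Suc k))"] nn multiplier_bounds[of k]
      by (intro mult_left_mono) auto
    also have "\<dots> = slope_new k * - min ?s 0 + slope_new k * (max h32 0 * \<mu> k)"
      by (rule distrib_left)
    also have "\<dots> \<le> (\<phi>31 + \<phi>32) * \<mu> k + 1 * (max h32 0 * \<mu> k)"
    proof (rule add_mono)
      show "slope_new k * - min ?s 0 \<le> (\<phi>31 + \<phi>32) * \<mu> k"
        using deriv_times_negative_le[OF \<mu>_pos[of k], of ?s] nn by (cases "?s \<le> 0") auto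
      show "slope_new k * (max h32 0 * \<mu> k) \<le> 1 * (max h32 0 * \<mu> k)"
        using multiplier_bounds[of k] nn by (intro mult_right_mono) auto
    qed
    finally show ?thesis using nn by (simp add: distrib_right)
  qed
qed

end

section \<open>Convergence rate\<close>

theorem theorem3p2:
  fixes f P1 P2 :: "'a::euclidean_space \<Rightarrow> real"
    and C :: "'a set"
    and c :: "'a \<Rightarrow> 'b::euclidean_space"
    and h :: "'b \<Rightarrow> real"
    and g :: "'a \<Rightarrow> real"
    and hs :: "real \<Rightarrow> 'b \<Rightarrow> real"
    and \<phi>s :: "real \<Rightarrow> real \<Rightarrow> real"
    and Lf Lc Mc Mh :: real
    and h1 h2 h31 h32 h3 h4 \<phi>1 \<phi>2 \<phi>31 \<phi>32 \<phi>3 \<phi>4 :: real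
    and \<alpha>1 \<alpha>2 \<alpha>31 \<alpha>4 :: real
    and L\<mu> :: "real \<Rightarrow> real"
    and Llow Lup c1 c2 M\<gamma>hat :: real
    and \<gamma>hat \<mu> \<gamma> lam \<delta> S :: "nat \<Rightarrow> real"
    and x :: "nat \<Rightarrow> 'a"
    and u :: "nat \<Rightarrow> 'b"
    and t :: "nat \<Rightarrow> nat"
    and mbar M_L Mf M1 Q0 :: real
  assumes g_def: "g = (\<lambda>x. h (c x))"
    and C: "compact C" "convex C"
    and feasible: "{x \<in> C. g x \<le> 0} \<noteq> {}"
    and f: "continuously_differentiable f" "smooth_on_set Lf C f" "Lf > 0"
    and c: "continuously_differentiable c" "smooth_on_set Lc C c" "Lc \<ge> 0"
      "Mc-lipschitz_on C c" "Mc > 0"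
    and P: "convex_on UNIV P1" "convex_on UNIV P2"
    and h: "convex_on UNIV h" "Mh-lipschitz_on UNIV h" "Mh > 0"
    and hs: "smoothing_approx h hs h1 h2 h31 h32" "smoothing_monotone hs h4"
    and \<phi>s: "smoothing_approx (\<lambda>s. max s 0) \<phi>s \<phi>1 \<phi>2 \<phi>31 \<phi>32" "smoothing_monotone \<phi>s \<phi>4"
    and h3_def: "h3 = h31 + h32"
    and \<phi>3_def: "\<phi>3 = \<phi>31 + \<phi>32"
    and \<alpha>1_def: "\<alpha>1 = h1 + Mh\<^sup>2 * \<phi>1"
    and \<alpha>2_def: "\<alpha>2 = h2 + Mh\<^sup>2 * \<phi>2"
    and \<alpha>31_def: "\<alpha>31 = max h31 0 + \<phi>31"
    and \<alpha>4_def: "\<alpha>4 = h4 + \<phi>4"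
    and L\<mu>_def: "L\<mu> = (\<lambda>m. Mh * Lc + \<alpha>1 * Mc\<^sup>2 + \<alpha>2 * Mc\<^sup>2 / m)"
    and inputs: "0 < Llow" "Llow \<le> Lup" "c1 > 0" "c2 > 0"
    and generated: "sESQM_generated f P1 P2 C c hs \<phi>s \<phi>3 Llow Lup c1 c2 \<gamma>hat x \<mu> t \<gamma>"
    and CQ: "CQ C g"
    and \<mu>: "\<forall>k. \<mu> k > 0" "decseq \<mu>" "\<mu> \<longlonglongrightarrow> 0"
    and S_def: "S = (\<lambda>K. \<Sum>k = nat \<lceil>real K / 2\<rceil>..K. \<mu> k)"
    and S: "filterlim S at_top sequentially"
    and \<gamma>hat: "\<gamma>hat \<longlonglongrightarrow> 0" "M\<gamma>hat > 1"
      "\<forall>k. 0 < \<gamma>hat (Suc k) \<and> \<gamma>hat (Suc k) < \<gamma>hat k \<and> \<gamma>hat k \<le> M\<gamma>hat * \<gamma>hat (Suc k)"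
    and mbar_def: "mbar = real_of_ereal (INF x. objective f P1 P2 C x)"
    and Mf_def: "Mf = (SUP x\<in>C. norm (grad f x))"
    and M_L_def: "M_L = max Lup (c1 + \<gamma> 0 * \<mu> 0 * Lf + \<mu> 0 * L\<mu> (\<mu> 0))"
    and M1_def: "M1 = M_L + \<mu> 0 * \<gamma>hat 0 * Lf + \<mu> 0 * L\<mu> (\<mu> 0)"
    and Q0_def: "Q0 = \<gamma> 0 * (real_of_ereal (objective f P1 P2 C (x 0)) - mbar)
                   + smoothed_constraint \<phi>s hs c (\<mu> 0) (x 0) + \<alpha>4 * \<mu> 0"
    and lam_def: "\<forall>k. lam (Suc k) = inverse (\<gamma> k) * deriv (\<phi>s (\<mu> k)) (hs (\<mu> k) (c (x (Suc k))))"
    and u_def: "\<forall>k. u (Suc k) = grad (hs (\<mu> k)) (c (x (Suc k)))"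
    and \<delta>_def: "\<forall>k. \<delta> (Suc k) =
      stationarity_residual f P1 P2 C c (x k) (x (Suc k)) (lam (Suc k)) (u (Suc k))"
  shows "(\<exists>\<eta>1. CQ_constant C c h \<eta>1) \<and>
    (\<forall>\<eta>1. CQ_constant C c h \<eta>1 \<longrightarrow>
      (let k0 = (LEAST k. \<mu> k \<le> \<eta>1 / max h3 (max h32 0));
           \<eta>\<gamma> = min (\<eta>1 / (2 * M\<gamma>hat * (Mf + subgradient_bound P1 C + subgradient_bound P2 C
                                         + c2 * (M_L + \<mu> 0 * L\<mu> (\<mu> 0)))))
                    (\<gamma>hat (k0 + 1));
           Mt = Max {t. \<gamma>hat t \<ge> \<eta>\<gamma>};
           M2 = 1 + 2 * (real Mt + 1) * (Q0 + max \<alpha>31 0 * \<mu> 0) / c1;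
           M3 = (3 * \<phi>3 + max h31 0 + max h32 0) / \<eta>\<gamma>
       in M2 > 0 \<and>
          (\<forall>K. K \<ge> 2 * Mt \<and> inverse (S K) \<le> (\<eta>\<gamma> * c2)\<^sup>2 / M2 \<longrightarrow>
            (let m = \<mu> (nat \<lceil>real K / 2\<rceil> - Mt)
             in \<exists>k \<in> {nat \<lceil>real K / 2\<rceil> - Mt..K}.
                  x (Suc k) \<in> C \<and>
                  lam (Suc k) \<in> {0..inverse \<eta>\<gamma>} \<and>
                  u (Suc k) \<in> eps_subdiff (h3 * m) (\<lambda>y. ereal (h y)) (c (x (Suc k))) \<and>
                  norm (x (Suc k) - x k) \<le> sqrt M2 * m / sqrt (S K) \<and>
                  \<delta> (Suc k) \<le> inverse \<eta>\<gamma> * M1 * sqrt M2 / sqrt (S K) \<and>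
                  max (g (x (Suc k))) 0 \<le> (3 * \<phi>3 + max h31 0) * m \<and>
                  \<bar>lam (Suc k) * g (x (Suc k))\<bar> \<le> M3 * m))))"
proof -
  have \<gamma>hat_pos: "0 < \<gamma>hat k" for k
    using \<gamma>hat(3) by (meson less_trans)
  have \<gamma>hat_dec: "decseq \<gamma>hat"
    using \<gamma>hat(3) by (intro decseq_SucI) (simp add: less_imp_le)
  interpret run: sESQM_run \<phi>s \<phi>1 \<phi>2 \<phi>31 \<phi>32 C c h hs Lc Mc Mh h1 h2 h31 h32
    f P1 P2 Lf h4 \<phi>4 Llow Lup c1 c2 \<gamma>hat \<mu> \<gamma> x t
    using \<phi>s hs C c(1,2,4) h(2) f(1,2) P inputs generated[unfolded \<phi>3_def] \<mu> \<gamma>hat(1) \<gamma>hat_pos \<gamma>hat_dec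
    by unfold_locales blast+
  have L\<mu>: "L\<mu> m = run.L_G m" for m
    by (simp add: L\<mu>_def run.L_G_def \<alpha>1_def \<alpha>2_def)
  have M_L: "M_L = run.L_max"
    by (simp add: M_L_def run.L_max_def L\<mu>)
  have gamma_terms_bound: "Mf + subgradient_bound P1 C + subgradient_bound P2 C + c2 * (M_L + \<mu> 0 * L\<mu> (\<mu> 0)) = run.gamma_terms_bound"
    by (simp add: run.gamma_terms_bound_def Mf_def M_L L\<mu>)
  have "objective f P1 P2 C (x 0) = ereal (run.F (x 0))"
    using run.x_0 by (simp add: objective_def delta_def)
  then have Q0: "Q0 = run.Q 0"
    by (simp add: Q0_def mbar_def \<alpha>4_def)
  show ?thesis
  proof (intro conjI allI impI, goal_cases)
    case 1
    then show ?case
      using CQ_imp_CQ_constant[OF C(1) c(1) h(2)] CQ by (simp add: g_def)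
  next
    case (2 \<eta>1)
    define k0 where "k0 = (LEAST k. \<mu> k \<le> \<eta>1 / max h3 (max h32 0))"
    define \<eta>\<gamma> where "\<eta>\<gamma> = min (\<eta>1 / (2 * M\<gamma>hat * (Mf + subgradient_bound P1 C + subgradient_bound P2 C
      + c2 * (M_L + \<mu> 0 * L\<mu> (\<mu> 0))))) (\<gamma>hat (k0 + 1))"
    define Mt where "Mt = Max {t. \<gamma>hat t \<ge> \<eta>\<gamma>}"
    define M2 where "M2 = 1 + 2 * (real Mt + 1) * (Q0 + max \<alpha>31 0 * \<mu> 0) / c1"
    define M3 where "M3 = (3 * \<phi>3 + max h31 0 + max h32 0) / \<eta>\<gamma>"
    have \<eta>\<gamma>_eq: "\<eta>\<gamma> = min (\<eta>1 / (2 * M\<gamma>hat * run.gamma_terms_bound))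
        (\<gamma>hat ((LEAST k. \<mu> k \<le> \<eta>1 / max (h31 + h32) (max h32 0)) + 1))"
      by (simp add: \<eta>\<gamma>_def k0_def gamma_terms_bound h3_def)
    have grow: "\<gamma>hat k \<le> M\<gamma>hat * \<gamma>hat (Suc k)" for k using \<gamma>hat(3) by blast
    note t_bounded = run.t_bounded[OF 2 \<gamma>hat(2) grow, folded \<eta>\<gamma>_eq]
    have \<eta>\<gamma>: "0 < \<eta>\<gamma>" and t: "t k \<le> Mt" and \<gamma>: "\<eta>\<gamma> \<le> \<gamma> k" for k
      unfolding Mt_def by (fact t_bounded)+
    have Q0_nonneg: "0 \<le> Q0 + max \<alpha>31 0 * \<mu> 0"
      using run.Q_0_plus_nonneg by (simp add: Q0 \<alpha>31_def)
    (* The summand 1 of M2 makes the bound strict. *)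
    have M2: "2 * (run.Q 0 + max run.\<alpha>31 0 * \<mu> 0) / c1 < M2"
    proof -
      let ?q = "(Q0 + max \<alpha>31 0 * \<mu> 0) / c1"
      have "0 \<le> real Mt * ?q" using Q0_nonneg inputs(3) by simp
      moreover have "M2 = 1 + 2 * (real Mt * ?q) + 2 * ?q"
        by (simp add: M2_def algebra_simps add_divide_distrib)
      ultimately have "2 * ?q < M2" by linarith
      then show ?thesis by (simp add: Q0 \<alpha>31_def)
    qed
    have "0 < M2"
      using Q0_nonneg inputs(3) by (simp add: M2_def add_pos_nonneg)
    have main: "\<exists>k \<in> {nat \<lceil>real K / 2\<rceil> - Mt..K}.
        x (Suc k) \<in> C \<and>
        lam (Suc k) \<in> {0..inverse \<eta>\<gamma>} \<and>
        u (Suc k) \<in> eps_subdiff (h3 * m) (\<lambda>y. ereal (h y)) (c (x (Suc k))) \<and>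
        norm (x (Suc k) - x k) \<le> sqrt M2 * m / sqrt (S K) \<and>
        \<delta> (Suc k) \<le> inverse \<eta>\<gamma> * M1 * sqrt M2 / sqrt (S K) \<and>
        max (g (x (Suc k))) 0 \<le> (3 * \<phi>3 + max h31 0) * m \<and>
        \<bar>lam (Suc k) * g (x (Suc k))\<bar> \<le> M3 * m"
      if K: "2 * Mt \<le> K" and SK: "inverse (S K) \<le> (\<eta>\<gamma> * c2)\<^sup>2 / M2"
        and m_def: "m = \<mu> (nat \<lceil>real K / 2\<rceil> - Mt)" for K m
    proof -
      let ?a = "nat \<lceil>real K / 2\<rceil>"
      have "Mt \<le> ?a" "?a \<le> K" using K by linarith+
      have "S K = (\<Sum>k = ?a..K. \<mu> k)" by (simp add: S_def)
      with run.exists_short_step[OF t \<gamma> \<eta>\<gamma> \<open>Mt \<le> ?a\<close> \<open>?a \<le> K\<close> M2] SK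
      obtain k where k: "k \<in> {?a - Mt..K}" and len: "run.len k \<le> sqrt M2 * \<mu> k / sqrt (S K)"
        and feas: "hs (\<mu> k) (c (x (Suc k))) \<le> 2 * (\<phi>31 + \<phi>32) * \<mu> k"
        by metis
      have "0 < S K" using \<open>S K = _\<close> \<open>?a \<le> K\<close> \<mu>(1) by (auto intro!: sum_pos)
      (* The smoothing parameter at k is at most m, its value at the start of the window. *)
      have \<mu>k: "0 < \<mu> k" "\<mu> k \<le> m"
        using \<mu>(1) k run.\<mu>_le by (auto simp: m_def)
      have \<gamma>k: "0 < \<gamma> k" "inverse (\<gamma> k) \<le> inverse \<eta>\<gamma>"
        using \<gamma>[of k] \<eta>\<gamma> by (auto intro: le_imp_inverse_le)
      note slope = run.multiplier_bounds[of k]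
      have lam: "lam (Suc k) = inverse (\<gamma> k) * run.slope_new k"
        using lam_def by simp
      have "inverse (\<gamma> k) * run.slope_new k \<le> inverse \<eta>\<gamma> * 1"
        using slope \<gamma>k \<eta>\<gamma> by (intro mult_mono) auto
      then have "lam (Suc k) \<in> {0..inverse \<eta>\<gamma>}"
        using slope \<gamma>k by (simp add: lam)
      moreover have "u (Suc k) \<in> eps_subdiff (h3 * m) (\<lambda>y. ereal (h y)) (c (x (Suc k)))"
        using smoothing_gradient_eps_subgradient[OF hs(1) \<mu>k(1), of "c (x (Suc k))"] u_def
          mult_left_mono[OF \<mu>k(2), of h3] smoothing_approxD(3)[OF hs(1)]
        by (auto simp: h3_def intro: eps_subdiff_mono)
      moreover have "norm (x (Suc k) - x k) \<le> sqrt M2 * m / sqrt (S K)"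
      proof -
        have "sqrt M2 * \<mu> k / sqrt (S K) \<le> sqrt M2 * m / sqrt (S K)"
          using \<mu>k \<open>0 < M2\<close> \<open>0 < S K\<close> by (intro divide_right_mono mult_left_mono) auto
        with len show ?thesis by linarith
      qed
      moreover have "\<delta> (Suc k) \<le> inverse \<eta>\<gamma> * M1 * sqrt M2 / sqrt (S K)"
      proof -
        have M1: "M1 = run.L_max + \<mu> 0 * \<gamma>hat 0 * Lf + \<mu> 0 * run.L_G (\<mu> 0)"
          by (simp add: M1_def M_L L\<mu>)
        then have "0 \<le> M1"
          using run.L_max_pos \<mu>(1) \<gamma>hat_pos[of 0] f(3) run.L_G_nonneg[of "\<mu> 0"] by (simp add: less_imp_le)
        have "\<delta> (Suc k) \<le> inverse (\<gamma> k) * M1 * (run.len k / \<mu> k)"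
          using run.residual_le[of k] \<delta>_def lam u_def by (simp add: M1)
        also have "\<dots> \<le> inverse \<eta>\<gamma> * M1 * (sqrt M2 / sqrt (S K))"
        proof (intro mult_mono)
          show "run.len k / \<mu> k \<le> sqrt M2 / sqrt (S K)"
            using len \<mu>k(1) by (simp add: pos_divide_le_eq)
        qed (use \<gamma>k \<eta>\<gamma> \<open>0 \<le> M1\<close> \<mu>k \<open>0 < M2\<close> in auto)
        finally show ?thesis by simp
      qed
      moreover have "max (g (x (Suc k))) 0 \<le> (3 * \<phi>3 + max h31 0) * m"
      proof -
        have "(3 * \<phi>3 + max h31 0) * \<mu> k \<le> (3 * \<phi>3 + max h31 0) * m"
          using \<mu>k smoothing_approxD(3)[OF \<phi>s(1)] by (intro mult_left_mono) (auto simp: \<phi>3_def)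
        with run.constraint_le[OF feas] show ?thesis by (simp add: g_def \<phi>3_def)
      qed
      moreover have "\<bar>lam (Suc k) * g (x (Suc k))\<bar> \<le> M3 * m"
      proof -
        have "\<bar>lam (Suc k) * g (x (Suc k))\<bar> = inverse (\<gamma> k) * \<bar>run.slope_new k * h (c (x (Suc k)))\<bar>"
          using \<gamma>k by (simp add: lam g_def abs_mult)
        also have "\<dots> \<le> inverse \<eta>\<gamma> * ((3 * \<phi>3 + max h31 0 + max h32 0) * m)"
        proof (intro mult_mono \<gamma>k)
          have "(3 * \<phi>3 + max h31 0 + max h32 0) * \<mu> k \<le> (3 * \<phi>3 + max h31 0 + max h32 0) * m"
            using \<mu>k smoothing_approxD(3)[OF \<phi>s(1)] by (intro mult_left_mono) (auto simp: \<phi>3_def)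
          with run.complementarity_le[OF feas]
          show "\<bar>run.slope_new k * h (c (x (Suc k)))\<bar> \<le> (3 * \<phi>3 + max h31 0 + max h32 0) * m"
            by (simp add: \<phi>3_def)
        qed (use \<eta>\<gamma> in auto)
        also have "\<dots> = M3 * m" by (simp add: M3_def divide_inverse)
        finally show ?thesis .
      qed
      ultimately show ?thesis using k run.x_in_C by blast
    qed
    have "0 < M2 \<and> (\<forall>K. K \<ge> 2 * Mt \<and> inverse (S K) \<le> (\<eta>\<gamma> * c2)\<^sup>2 / M2 \<longrightarrow>
        (let m = \<mu> (nat \<lceil>real K / 2\<rceil> - Mt)
         in \<exists>k \<in> {nat \<lceil>real K / 2\<rceil> - Mt..K}.
              x (Suc k) \<in> C \<and>
              lam (Suc k) \<in> {0..inverse \<eta>\<gamma>} \<and>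
              u (Suc k) \<in> eps_subdiff (h3 * m) (\<lambda>y. ereal (h y)) (c (x (Suc k))) \<and>
              norm (x (Suc k) - x k) \<le> sqrt M2 * m / sqrt (S K) \<and>
              \<delta> (Suc k) \<le> inverse \<eta>\<gamma> * M1 * sqrt M2 / sqrt (S K) \<and>
              max (g (x (Suc k))) 0 \<le> (3 * \<phi>3 + max h31 0) * m \<and>
              \<bar>lam (Suc k) * g (x (Suc k))\<bar> \<le> M3 * m))"
      using \<open>0 < M2\<close> main unfolding Let_def by blast
    then show ?case
      unfolding Let_def k0_def \<eta>\<gamma>_def Mt_def M2_def M3_def .
  qed
qed

end
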